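(* Consider the Cauchy problem $$u_{tt}-\Delta u+b(t)u_t-g(t)\Delta u_t=0,\quad (t,x)\in[0,\infty)\times\mathbb{R}^n,\qquad u(0,x)=u_0(x),\quad u_t(0,x)=u_1(x),\quad x\in\mathbb{R}^n,$$ with $b(t)=e^t$ and $g(t)=\frac12e^{-t}$. Then Sobolev solutions satisfy $$\||D|^{|\beta|}u(t,\cdot)\|_{L^2}\lesssim\|u_0\|_{\dot H^{|\beta|}\cap\dot H^{|\beta|+1}}+\|u_1\|_{\dot H^{|\beta|-1}\cap\dot H^{|\beta|}}\quad\text{for }|\beta|\ge1,$$ $$\||D|^{|\beta|}u_t(t,\cdot)\|_{L^2}\lesssim\|u_0\|_{\dot H^{|\beta|+1}\cap\dot H^{|\beta|+2}}+\|u_1\|_{\dot H^{|\beta|}\cap\dot H^{|\beta|+1}}\quad\text{for }|\beta|\ge0.$$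
   Context: $f\lesssim h$ means $f\le Ch$ with a constant $C>0$ independent of $t$ and of the data. $|D|^a$ is the Fourier multiplier with symbol $|\xi|^a$; $\dot H^a=\dot H^a(\mathbb{R}^n)$ is the Riesz potential space based on $L^2$ with norm $\||\xi|^a\hat f\|_{L^2}$; the norm of an intersection is the sum of the norms. $|\beta|$ denotes the order of differentiation (a number). Each estimate is understood for data for which its right-hand side is finite. Sobolev solutions are understood via the partial Fourier transform in $x$: $\hat u(t,\xi)$ solves $\hat u_{tt}+|\xi|^2\hat u+(b(t)+g(t)|\xi|^2)\hat u_t=0$, $\hat u(0,\xi)=\hat u_0(\xi)$, $\hat u_t(0,\xi)=\hat u_1(\xi)$. *)

theory Defs
  imports "HOL-Analysis.Analysis"
begin

section \<open>Schwartz functions and the Fourier transform\<close>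

definition partial_deriv :: "(real^'n) list \<Rightarrow> (real^'n \<Rightarrow> complex) \<Rightarrow> real^'n \<Rightarrow> complex" where
  "partial_deriv vs f = foldr (\<lambda>v h x. frechet_derivative h (at x) v) vs f"

definition multi_indices :: "(real^'n) list set" where
  "multi_indices = {vs. set vs \<subseteq> Basis}"

text \<open>A multi-index is encoded as a list of coordinate directions. Since the
  iterated partial derivatives of every order are required to be (totally) differentiable, the
  functions below are smooth.\<close>

definition schwartz :: "(real^'n \<Rightarrow> complex) set" where
  "schwartz = {f. \<forall>vs\<in>multi_indices.
      (\<forall>x. partial_deriv vs f differentiable (at x)) \<and>
      (\<forall>k::nat. bounded (range (\<lambda>x. (1 + norm x) ^ k *\<^sub>R partial_deriv vs f x)))}"

definition schwartz_seminorm :: "nat \<Rightarrow> (real^'n \<Rightarrow> complex) \<Rightarrow> real" where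
  "schwartz_seminorm N f =
     (\<Sum>vs | vs \<in> multi_indices \<and> length vs \<le> N.
        SUP x. (1 + norm x) ^ N * norm (partial_deriv vs f x))"

definition fourier :: "(real^'n \<Rightarrow> complex) \<Rightarrow> real^'n \<Rightarrow> complex" where
  "fourier f \<xi> =
     of_real ((2 * pi) powr (- real CARD('n) / 2)) * (LINT x|lborel. cis (- (\<xi> \<bullet> x)) * f x)"

definition inv_fourier :: "(real^'n \<Rightarrow> complex) \<Rightarrow> real^'n \<Rightarrow> complex" where
  "inv_fourier f x =
     of_real ((2 * pi) powr (- real CARD('n) / 2)) * (LINT \<xi>|lborel. cis (x \<bullet> \<xi>) * f \<xi>)"


section \<open>The distributions underlying the Riesz potential spaces\<close>

text \<open>\<open>flat\<close> consists of the Schwartz functions all of whose derivatives vanish at the origin, and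
  \<open>test_Z\<close> of those whose Fourier transform is flat. The dual \<open>dist_Z\<close> of \<open>test_Z\<close> is the space
  of tempered distributions modulo polynomials. Only the values of a functional on \<open>test_Z\<close>
  matter.\<close>

definition flat :: "(real^'n \<Rightarrow> complex) set" where
  "flat = {\<psi>\<in>schwartz. \<forall>vs\<in>multi_indices. partial_deriv vs \<psi> 0 = 0}"

definition test_Z :: "(real^'n \<Rightarrow> complex) set" where
  "test_Z = {\<phi>\<in>schwartz. \<forall>vs\<in>multi_indices. partial_deriv vs (fourier \<phi>) 0 = 0}"

definition dist_Z :: "((real^'n \<Rightarrow> complex) \<Rightarrow> complex) set" where
  "dist_Z = {T.
     (\<forall>\<phi>\<in>test_Z. \<forall>\<eta>\<in>test_Z. \<forall>c d. T (\<lambda>x. c * \<phi> x + d * \<eta> x) = c * T \<phi> + d * T \<eta>) \<and>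
     (\<exists>C N. \<forall>\<phi>\<in>test_Z. norm (T \<phi>) \<le> C * schwartz_seminorm N \<phi>)}"

text \<open>The Fourier transform of a distribution is defined by duality. \<open>fourier_repr T F\<close> says that it
  is given by the function \<open>F\<close>, which is then determined almost everywhere; \<open>fhat T\<close> is a
  representative.\<close>

definition fourier_repr ::
    "((real^'n \<Rightarrow> complex) \<Rightarrow> complex) \<Rightarrow> (real^'n \<Rightarrow> complex) \<Rightarrow> bool" where
  "fourier_repr T F \<longleftrightarrow> T \<in> dist_Z \<and> F \<in> borel_measurable lborel \<and>
     (\<forall>\<psi>\<in>flat. integrable lborel (\<lambda>\<xi>. F \<xi> * \<psi> \<xi>) \<and>
        T (fourier \<psi>) = (LINT \<xi>|lborel. F \<xi> * \<psi> \<xi>))"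

definition has_fhat :: "((real^'n \<Rightarrow> complex) \<Rightarrow> complex) \<Rightarrow> bool" where
  "has_fhat T \<longleftrightarrow> (\<exists>F. fourier_repr T F)"

definition fhat :: "((real^'n \<Rightarrow> complex) \<Rightarrow> complex) \<Rightarrow> real^'n \<Rightarrow> complex" where
  "fhat T = (SOME F. fourier_repr T F)"


section \<open>Norms and Fourier multipliers\<close>

definition square_integrable :: "(real^'n \<Rightarrow> complex) \<Rightarrow> bool" where
  "square_integrable f \<longleftrightarrow>
     f \<in> borel_measurable lborel \<and> integrable lborel (\<lambda>x. (norm (f x))\<^sup>2)"

definition L2_norm_fun :: "(real^'n \<Rightarrow> complex) \<Rightarrow> ennreal" where
  "L2_norm_fun f =
     (if square_integrable f then ennreal (sqrt (LINT x|lborel. (norm (f x))\<^sup>2)) else \<infinity>)"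

text \<open>The \<open>L\<^sup>2\<close> norm of a distribution: the infimum runs over the functions in \<open>L\<^sup>2\<close> representing the
  distribution. These agree almost everywhere because \<open>test_Z\<close> is dense in \<open>L\<^sup>2\<close>, so the infimum
  is over at most one value; it is \<open>\<infinity>\<close> if the distribution is not in \<open>L\<^sup>2\<close>.\<close>

definition L2_norm_dist :: "((real^'n \<Rightarrow> complex) \<Rightarrow> complex) \<Rightarrow> ennreal" where
  "L2_norm_dist S =
     (INF h \<in> {h. square_integrable h \<and> (\<forall>\<phi>\<in>test_Z. S \<phi> = (LINT x|lborel. h x * \<phi> x))}.
        L2_norm_fun h)"

text \<open>The distribution with Fourier transform \<open>\<xi> \<mapsto> m \<xi> * fhat T \<xi>\<close>; meaningful if \<open>has_fhat T\<close>.\<close>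

definition fourier_multiplier ::
    "(real^'n \<Rightarrow> real) \<Rightarrow> ((real^'n \<Rightarrow> complex) \<Rightarrow> complex) \<Rightarrow> (real^'n \<Rightarrow> complex) \<Rightarrow> complex" where
  "fourier_multiplier m T =
     (\<lambda>\<phi>. LINT \<xi>|lborel. of_real (m \<xi>) * fhat T \<xi> * inv_fourier \<phi> \<xi>)"

definition abs_D ::
    "real \<Rightarrow> ((real^'n \<Rightarrow> complex) \<Rightarrow> complex) \<Rightarrow> (real^'n \<Rightarrow> complex) \<Rightarrow> complex" where
  "abs_D a = fourier_multiplier (\<lambda>\<xi>. norm \<xi> powr a)"

definition Hdot_norm :: "real \<Rightarrow> ((real^'n \<Rightarrow> complex) \<Rightarrow> complex) \<Rightarrow> ennreal" where
  "Hdot_norm a T =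
     (if has_fhat T then L2_norm_fun (\<lambda>\<xi>. of_real (norm \<xi> powr a) * fhat T \<xi>) else \<infinity>)"

definition Hdot_Int_norm :: "real \<Rightarrow> real \<Rightarrow> ((real^'n \<Rightarrow> complex) \<Rightarrow> complex) \<Rightarrow> ennreal" where
  "Hdot_Int_norm a a' T = Hdot_norm a T + Hdot_norm a' T"


section \<open>Sobolev solutions\<close>

text \<open>\<open>u\<close> and \<open>ut\<close> are the solution and its time derivative, both as functions of time with values
  in \<open>dist_Z\<close>. The equation, the initial conditions and the relation between \<open>u\<close> and \<open>ut\<close> are
  expressed through the partial Fourier transforms \<open>U\<close> of \<open>u\<close> and \<open>V\<close> of \<open>ut\<close>: for almost every
  frequency, \<open>V\<close> is the time derivative of \<open>U\<close>, and \<open>w\<close> is the second time derivative of \<open>U\<close>.\<close>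

definition sobolev_solution ::
    "(real \<Rightarrow> real) \<Rightarrow> (real \<Rightarrow> real) \<Rightarrow>
     ((real^'n \<Rightarrow> complex) \<Rightarrow> complex) \<Rightarrow> ((real^'n \<Rightarrow> complex) \<Rightarrow> complex) \<Rightarrow>
     (real \<Rightarrow> (real^'n \<Rightarrow> complex) \<Rightarrow> complex) \<Rightarrow> (real \<Rightarrow> (real^'n \<Rightarrow> complex) \<Rightarrow> complex) \<Rightarrow> bool" where
  "sobolev_solution b g u0 u1 u ut \<longleftrightarrow>
     has_fhat u0 \<and> has_fhat u1 \<and> (\<forall>t\<ge>0. has_fhat (u t) \<and> has_fhat (ut t)) \<and>
     (\<exists>U V :: real \<Rightarrow> real^'n \<Rightarrow> complex.
        (\<forall>t\<ge>0. AE \<xi> in lborel. U t \<xi> = fhat (u t) \<xi> \<and> V t \<xi> = fhat (ut t) \<xi>) \<and>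
        (AE \<xi> in lborel.
           U 0 \<xi> = fhat u0 \<xi> \<and> V 0 \<xi> = fhat u1 \<xi> \<and>
           (\<forall>t\<ge>0. ((\<lambda>s. U s \<xi>) has_vector_derivative V t \<xi>) (at t within {0..}) \<and>
              (\<exists>w. ((\<lambda>s. V s \<xi>) has_vector_derivative w) (at t within {0..}) \<and>
                 w + of_real ((norm \<xi>)\<^sup>2) * U t \<xi>
                   + of_real (b t + g t * (norm \<xi>)\<^sup>2) * V t \<xi> = 0))))"

end

theory Submission
  imports Defs "HOL-Probability.Characteristic_Functions" "HOL-Probability.Sinc_Integral"
begin

text \<open>
At a fixed frequency \<open>\<xi>\<close> the partial Fourier transform of \<open>u\<close> solves the equation of an oscillator
with frequency \<open>norm \<xi>\<close> and nonnegative friction \<open>b t + g t * (norm \<xi>)\<^sup>2\<close>. Its energy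
\<open>(norm V)\<^sup>2 + (norm \<xi>)\<^sup>2 * (norm U)\<^sup>2\<close>, where \<open>V\<close> is the time derivative of \<open>U\<close>, does not increase
(\<open>energy_nonincreasing\<close>). Hence both \<open>norm V\<close> and \<open>norm \<xi> * norm U\<close> are at most
\<open>norm \<xi> * norm (fhat u0 \<xi>) + norm (fhat u1 \<xi>)\<close> at every time, for almost every \<open>\<xi>\<close>. Multiplied by
powers of \<open>norm \<xi>\<close>, these bounds give the two estimates with the constant 2, as soon as the \<open>L\<^sup>2\<close> norm of a distribution is
controlled by the \<open>L\<^sup>2\<close> norm of its Fourier transform (\<open>L2_norm_dist_abs_D_le\<close>).

For this last step a function in \<open>L\<^sup>2\<close> has to be found that represents the distribution. Let \<open>G\<close> be
the Fourier transform in question. The key is one half of Plancherel's theorem, the inequality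
\<open>plancherel_le\<close> for integrable functions: against a Gaussian weight the square of a Fourier integral
can be integrated by Fubini's theorem, which results in a convolution with a Gaussian probability
density, and the weight is then removed by a limit. The truncations of \<open>G\<close> to balls are integrable,
and by this inequality their transforms form a Cauchy sequence in \<open>L\<^sup>2\<close>, whose limit is the function
sought (\<open>L2_fourier_transform_exists\<close>).
\<close>

section \<open>Gaussians and their Fourier transforms\<close>

lemma has_bochner_integral_lborel_prod_inner:
  fixes f :: "'a::euclidean_space \<Rightarrow> real \<Rightarrow> 'b::{real_normed_field, banach, second_countable_topology}"
  assumes f: "\<And>b. b \<in> Basis \<Longrightarrow> integrable lborel (f b)"
  shows "has_bochner_integral lborel (\<lambda>x::'a. \<Prod>b\<in>Basis. f b (x \<bullet> b))
    (\<Prod>b\<in>Basis. LINT x|lborel. f b x)"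
proof -
  have sf: "product_sigma_finite (\<lambda>_::'a. lborel :: real measure)"
    by (simp add: product_sigma_finite_def sigma_finite_lborel)
  let ?T = "\<lambda>c. \<Sum>b\<in>(Basis::'a set). c b *\<^sub>R b"
  have m: "f b \<in> borel_measurable borel" if "b \<in> Basis" for b
    using f[OF that] by auto
  have [measurable]: "(\<lambda>x::'a. \<Prod>b\<in>Basis. f b (x \<bullet> b)) \<in> borel_measurable borel"
    by (intro borel_measurable_prod measurable_compose[OF _ m]) auto
  have [measurable]: "?T \<in> measurable (\<Pi>\<^sub>M b\<in>(Basis::'a set). lborel) borel"
    by measurable
  have coord: "(\<Prod>b\<in>Basis. f b (?T c \<bullet> b)) = (\<Prod>b\<in>Basis. f b (c b))" for c
    by (intro prod.cong refl) (simp add: inner_sum_left inner_Basis if_distrib cong: if_cong)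
  have eq: "(lborel :: 'a measure) = distr (\<Pi>\<^sub>M b\<in>(Basis::'a set). lborel) borel ?T"
    by (rule lborel_eq)
  have "integrable lborel (\<lambda>x::'a. \<Prod>b\<in>Basis. f b (x \<bullet> b))"
    unfolding eq
    by (subst integrable_distr_eq) (auto simp: coord intro!: product_sigma_finite.product_integrable_prod[OF sf] f)
  moreover have "(LINT x|lborel. (\<Prod>b\<in>Basis. f b ((x::'a) \<bullet> b))) =
      (LINT c|(\<Pi>\<^sub>M b\<in>(Basis::'a set). lborel). (\<Prod>b\<in>Basis. f b (c b)))"
    unfolding eq by (subst integral_distr) (simp_all add: coord)
  moreover have "\<dots> = (\<Prod>b\<in>Basis. LINT x|lborel. f b x)"
    by (rule product_sigma_finite.product_integral_prod[OF sf]) (auto intro: f)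
  ultimately show ?thesis by (simp add: has_bochner_integral_iff)
qed

lemma borel_measurable_cis [measurable]: "cis \<in> borel_measurable borel"
  by (intro borel_measurable_continuous_onI continuous_intros)

text \<open>The transform of the unnormalised Gaussian with variance \<open>\<sigma>\<^sup>2\<close> is, up to the factor \<open>2 * pi\<close>,
the probability density with variance \<open>1 / \<sigma>\<^sup>2\<close>. This normalisation leaves no \<open>\<sigma>\<close> outside the density, so the bound obtained
in \<open>weighted_plancherel_le\<close> is uniform in \<open>\<sigma>\<close>. The formula is the characteristic function of the
standard normal distribution after the substitution \<open>x \<mapsto> \<sigma> * x\<close>.\<close>

lemma has_bochner_integral_cis_gaussian_real:
  fixes \<sigma> s :: real
  assumes "\<sigma> > 0"
  shows "has_bochner_integral lborel (\<lambda>x. cis (s * x) * of_real (exp (- x\<^sup>2 / (2 * \<sigma>\<^sup>2))))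
    (of_real (2 * pi * normal_density 0 (1 / \<sigma>) s))"
proof -
  have "exp (- x\<^sup>2 / (2 * \<sigma>\<^sup>2)) = sqrt (2 * pi * \<sigma>\<^sup>2) * normal_density 0 \<sigma> x" for x
    using assms by (simp add: normal_density_def)
  then have int: "integrable lborel (\<lambda>x. exp (- x\<^sup>2 / (2 * \<sigma>\<^sup>2)))"
    using assms by (simp add: integrable_normal_density)
  have "integrable lborel (\<lambda>x. cis (s * x) * of_real (exp (- x\<^sup>2 / (2 * \<sigma>\<^sup>2))))"
    by (rule Bochner_Integration.integrable_bound[OF int]) (auto simp: norm_mult)
  moreover have "(LINT x|lborel. cis (s * x) * of_real (exp (- x\<^sup>2 / (2 * \<sigma>\<^sup>2)))) =
      of_real (2 * pi * normal_density 0 (1 / \<sigma>) s)"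
  proof -
    have "(LINT x|lborel. cis (s * x) * of_real (exp (- x\<^sup>2 / (2 * \<sigma>\<^sup>2)))) =
        \<sigma> *\<^sub>R (LINT x|lborel. cis (s * \<sigma> * x) * of_real (exp (- x\<^sup>2 / 2)))"
      using assms by (subst lborel_integral_real_affine[where c = \<sigma> and t = 0])
        (simp_all add: power_mult_distrib mult_ac)
    also have "(LINT x|lborel. cis (s * \<sigma> * x) * of_real (exp (- x\<^sup>2 / 2))) =
        (LINT x|lborel. sqrt (2 * pi) *\<^sub>R (std_normal_density x *\<^sub>R iexp (s * \<sigma> * x)))"
      by (intro Bochner_Integration.integral_cong refl)
        (simp add: std_normal_density_def cis_conv_exp scaleR_conv_of_real mult_ac)
    also have "\<dots> = sqrt (2 * pi) *\<^sub>R char std_normal_distribution (s * \<sigma>)"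
      unfolding char_def
      by (subst Bochner_Integration.integral_scaleR_right, subst integral_density) auto
    also have "\<sigma> *\<^sub>R \<dots> = of_real (2 * pi * normal_density 0 (1 / \<sigma>) s)"
    proof -
      have "\<sigma> * (sqrt (2 * pi) * exp (- (s * \<sigma>)\<^sup>2 / 2)) = 2 * pi * normal_density 0 (1 / \<sigma>) s"
        using assms real_sqrt_mult_self[of "2 * pi"]
        by (simp add: normal_density_def real_sqrt_divide field_simps real_sqrt_mult)
      then show ?thesis
        by (simp only: char_std_normal_distribution scaleR_conv_of_real of_real_mult[symmetric])
    qed
    finally show ?thesis .
  qed
  ultimately show ?thesis by (simp add: has_bochner_integral_iff)
qed

text \<open>Both Gaussians are written as products over the coordinates rather than with \<open>(norm x)\<^sup>2\<close>, so that
their integrals factorise into one-dimensional ones.\<close>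

definition gauss_weight :: "real \<Rightarrow> 'a::euclidean_space \<Rightarrow> real" where
  "gauss_weight \<sigma> x = (\<Prod>b\<in>Basis. exp (- (x \<bullet> b)\<^sup>2 / (2 * \<sigma>\<^sup>2)))"

definition gauss_density :: "real \<Rightarrow> 'a::euclidean_space \<Rightarrow> real" where
  "gauss_density \<sigma> x = (\<Prod>b\<in>Basis. normal_density 0 \<sigma> (x \<bullet> b))"

lemma gauss_weight_measurable [measurable]: "gauss_weight \<sigma> \<in> borel_measurable borel"
  unfolding gauss_weight_def by measurable

lemma gauss_density_measurable [measurable]: "gauss_density \<sigma> \<in> borel_measurable borel"
  unfolding gauss_density_def by measurable

lemma gauss_weight_pos: "gauss_weight \<sigma> x > 0"
  unfolding gauss_weight_def by (auto intro: prod_pos)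

lemma gauss_density_nonneg: "gauss_density \<sigma> x \<ge> 0"
  unfolding gauss_density_def by (auto intro: prod_nonneg)

lemma nn_integral_gauss_density:
  assumes "\<sigma> > 0"
  shows "(\<integral>\<^sup>+x. gauss_density \<sigma> (x::'a::euclidean_space) \<partial>lborel) = 1"
proof -
  have "(\<integral>\<^sup>+x. normal_density 0 \<sigma> x \<partial>lborel) = 1"
    using assms by (subst nn_integral_eq_integral) auto
  moreover have "(\<integral>\<^sup>+x. gauss_density \<sigma> (x::'a) \<partial>lborel) =
      (\<integral>\<^sup>+x. (\<Prod>b\<in>Basis. ennreal (normal_density 0 \<sigma> ((x::'a) \<bullet> b))) \<partial>lborel)"
    unfolding gauss_density_def by (simp add: prod_ennreal)
  ultimately show ?thesis
    by (subst (asm) nn_integral_lborel_prod) auto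
qed

lemma gauss_density_minus_commute: "gauss_density \<sigma> (x - y) = gauss_density \<sigma> (y - x)"
  by (simp add: gauss_density_def normal_density_def inner_diff_left power2_commute)

lemma nn_integral_gauss_density_diff:
  assumes "\<sigma> > 0"
  shows "(\<integral>\<^sup>+x. gauss_density \<sigma> (x - y :: 'a::euclidean_space) \<partial>lborel) = 1"
proof -
  have "(\<integral>\<^sup>+x. gauss_density \<sigma> (x - y) \<partial>lborel) =
      (\<integral>\<^sup>+x. gauss_density \<sigma> (x - y) \<partial>distr lborel borel ((+) y))"
    by (simp add: lborel_distr_plus)
  also have "\<dots> = 1"
    by (subst nn_integral_distr) (simp_all add: nn_integral_gauss_density[OF assms])
  finally show ?thesis .
qed

lemma cis_sum: "finite A \<Longrightarrow> cis (\<Sum>a\<in>A. f a) = (\<Prod>a\<in>A. cis (f a))"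
  by (induction A rule: finite_induct) (auto simp: cis_mult[symmetric])

lemma has_bochner_integral_cis_gauss_weight:
  fixes \<zeta> :: "'a::euclidean_space"
  assumes "\<sigma> > 0"
  shows "has_bochner_integral lborel (\<lambda>x. cis (x \<bullet> \<zeta>) * of_real (gauss_weight \<sigma> x))
    (of_real ((2 * pi) ^ DIM('a) * gauss_density (1 / \<sigma>) \<zeta>))"
proof -
  let ?f = "\<lambda>b x. cis ((\<zeta> \<bullet> b) * x) * complex_of_real (exp (- x\<^sup>2 / (2 * \<sigma>\<^sup>2)))"
  note real = has_bochner_integral_cis_gaussian_real[OF assms]
  have "cis (x \<bullet> \<zeta>) * of_real (gauss_weight \<sigma> x) = (\<Prod>b\<in>Basis. ?f b (x \<bullet> b))" for x
    by (subst euclidean_inner)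
      (simp add: gauss_weight_def cis_sum prod.distrib mult.commute)
  moreover have "of_real ((2 * pi) ^ DIM('a) * gauss_density (1 / \<sigma>) \<zeta>) =
      (\<Prod>b\<in>(Basis::'a set). LINT x|lborel. ?f b x)"
    by (simp only: has_bochner_integral_integral_eq[OF real])
      (simp add: gauss_density_def prod.distrib)
  moreover have "has_bochner_integral lborel (\<lambda>x::'a. \<Prod>b\<in>Basis. ?f b (x \<bullet> b))
      (\<Prod>b\<in>(Basis::'a set). LINT x|lborel. ?f b x)"
    by (intro has_bochner_integral_lborel_prod_inner integrable.intros[OF real])
  ultimately show ?thesis by simp
qed

section \<open>The Plancherel inequality\<close>

text \<open>Fatou's lemma, in the form in which a uniform bound passes to a pointwise limit.\<close>

lemma nn_integral_le_AE_limit: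
  fixes u :: "nat \<Rightarrow> 'a \<Rightarrow> ennreal"
  assumes [measurable]: "\<And>n. u n \<in> borel_measurable M"
    and lim: "AE x in M. (\<lambda>n. u n x) \<longlonglongrightarrow> v x"
    and bound: "\<And>n. (\<integral>\<^sup>+x. u n x \<partial>M) \<le> C"
  shows "(\<integral>\<^sup>+x. v x \<partial>M) \<le> C"
proof -
  have "(\<integral>\<^sup>+x. v x \<partial>M) = (\<integral>\<^sup>+x. liminf (\<lambda>n. u n x) \<partial>M)"
    using lim by (intro nn_integral_cong_AE) (auto simp: lim_imp_Liminf)
  also have "\<dots> \<le> liminf (\<lambda>n. \<integral>\<^sup>+x. u n x \<partial>M)"
    by (rule nn_integral_liminf) simp
  also have "\<dots> \<le> C"
    using bound by (intro Liminf_le) (auto intro: always_eventually)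
  finally show ?thesis .
qed

lemma integrable_lborel_tensor:
  fixes a :: "'a::euclidean_space \<Rightarrow> complex" and b :: "'b::euclidean_space \<Rightarrow> complex"
  assumes "integrable lborel a" "integrable lborel b"
  shows "integrable (lborel \<Otimes>\<^sub>M lborel) (\<lambda>(x, y). a x * b y)"
proof (rule lborel_pair.Fubini_integrable)
  show "(\<lambda>(x, y). a x * b y) \<in> borel_measurable (lborel \<Otimes>\<^sub>M lborel)"
    using assms by measurable
  show "integrable lborel (\<lambda>x. \<integral>y. norm (case (x, y) of (x, y) \<Rightarrow> a x * b y) \<partial>lborel)"
    using assms by (simp add: norm_mult)
  show "AE x in lborel. integrable lborel (\<lambda>y. case (x, y) of (x, y) \<Rightarrow> a x * b y)"
    using assms by simp
qed

text \<open>The inverse Fourier transform without its normalising factor \<open>(2 * pi) powr (- n / 2)\<close>.\<close>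

definition fourier_integral :: "('a::euclidean_space \<Rightarrow> complex) \<Rightarrow> 'a \<Rightarrow> complex" where
  "fourier_integral g x = (LINT \<xi>|lborel. cis (x \<bullet> \<xi>) * g \<xi>)"

lemma fourier_integral_measurable [measurable]:
  assumes [measurable]: "g \<in> borel_measurable lborel"
  shows "fourier_integral g \<in> borel_measurable lborel"
  unfolding fourier_integral_def by measurable

lemma integrable_cis_mult:
  fixes g :: "'a::euclidean_space \<Rightarrow> complex"
  assumes g: "integrable lborel g"
  shows "integrable lborel (\<lambda>\<xi>. cis (x \<bullet> \<xi>) * g \<xi>)"
proof -
  have [measurable]: "g \<in> borel_measurable lborel" using g by simp
  show ?thesis
    by (rule Bochner_Integration.integrable_bound[OF g]) (auto simp: norm_mult)
qed

lemma fourier_integral_duality: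
  fixes g \<phi> :: "'a::euclidean_space \<Rightarrow> complex"
  assumes g: "integrable lborel g" and \<phi>: "integrable lborel \<phi>"
  shows "(LINT \<xi>|lborel. g \<xi> * fourier_integral \<phi> \<xi>) = (LINT x|lborel. fourier_integral g x * \<phi> x)"
proof -
  have [measurable]: "g \<in> borel_measurable lborel" "\<phi> \<in> borel_measurable lborel"
    using assms by simp_all
  have int: "integrable (lborel \<Otimes>\<^sub>M lborel) (\<lambda>(\<xi>, x). cis (x \<bullet> \<xi>) * g \<xi> * \<phi> x)"
    by (rule Bochner_Integration.integrable_bound[OF integrable_lborel_tensor[OF g \<phi>]])
      (auto simp: norm_mult)
  have "(LINT \<xi>|lborel. g \<xi> * fourier_integral \<phi> \<xi>) =
      (LINT \<xi>|lborel. LINT x|lborel. cis (x \<bullet> \<xi>) * g \<xi> * \<phi> x)"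
    by (simp add: fourier_integral_def mult_ac inner_commute flip: integral_mult_right_zero)
  also have "\<dots> = (LINT x|lborel. LINT \<xi>|lborel. cis (x \<bullet> \<xi>) * g \<xi> * \<phi> x)"
    using lborel_pair.Fubini_integral[OF int] by simp
  also have "\<dots> = (LINT x|lborel. fourier_integral g x * \<phi> x)"
    by (simp add: fourier_integral_def)
  finally show ?thesis .
qed

text \<open>Young's inequality for convolution with a probability density: by the inequality between arithmetic
and geometric means the product \<open>norm (g \<xi>) * norm (g \<eta>)\<close> splits into two terms, each of which
depends on one variable only, and the density integrates to one in the other variable.\<close>

lemma nn_integral_gauss_convolution_le:
  fixes g :: "'a::euclidean_space \<Rightarrow> complex"
  assumes [measurable]: "g \<in> borel_measurable lborel" and "\<sigma> > 0"
  shows "(\<integral>\<^sup>+\<xi>. \<integral>\<^sup>+\<eta>. ennreal (norm (g \<xi>) * norm (g \<eta>) * gauss_density \<sigma> (\<xi> - \<eta>)) \<partial>lborel \<partial>lborel) \<le>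
    (\<integral>\<^sup>+\<xi>. ennreal ((norm (g \<xi>))\<^sup>2) \<partial>lborel)" (is "?L \<le> ?R")
proof -
  let ?P = "\<lambda>\<xi> \<eta>. ennreal (gauss_density \<sigma> (\<xi> - \<eta> :: 'a))"
  let ?G = "\<lambda>\<xi>. ennreal ((norm (g \<xi>))\<^sup>2 / 2)"
  have P1: "(\<integral>\<^sup>+\<xi>. ?P \<xi> \<eta> \<partial>lborel) = 1" for \<eta>
    using nn_integral_gauss_density_diff[OF \<open>\<sigma> > 0\<close>] .
  have P2: "(\<integral>\<^sup>+\<eta>. ?P \<xi> \<eta> \<partial>lborel) = 1" for \<xi>
    using P1 by (simp add: gauss_density_minus_commute[of \<sigma> \<xi>])
  have amgm: "ennreal (norm (g \<xi>) * norm (g \<eta>) * gauss_density \<sigma> (\<xi> - \<eta>)) \<le>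
      ?G \<xi> * ?P \<xi> \<eta> + ?G \<eta> * ?P \<xi> \<eta>" for \<xi> \<eta>
  proof -
    have "norm (g \<xi>) * norm (g \<eta>) \<le> (norm (g \<xi>))\<^sup>2 / 2 + (norm (g \<eta>))\<^sup>2 / 2"
      using sum_squares_bound[of "norm (g \<xi>)" "norm (g \<eta>)"] by simp
    then have "norm (g \<xi>) * norm (g \<eta>) * gauss_density \<sigma> (\<xi> - \<eta>) \<le>
        (norm (g \<xi>))\<^sup>2 / 2 * gauss_density \<sigma> (\<xi> - \<eta>) + (norm (g \<eta>))\<^sup>2 / 2 * gauss_density \<sigma> (\<xi> - \<eta>)"
      unfolding distrib_right[symmetric]
      by (rule mult_right_mono) (rule gauss_density_nonneg)
    then show ?thesis
      by (simp add: gauss_density_nonneg ennreal_leI flip: ennreal_mult ennreal_plus)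
  qed
  have "?L \<le> (\<integral>\<^sup>+\<xi>. \<integral>\<^sup>+\<eta>. ?G \<xi> * ?P \<xi> \<eta> + ?G \<eta> * ?P \<xi> \<eta> \<partial>lborel \<partial>lborel)"
    by (intro nn_integral_mono amgm)
  also have "\<dots> = (\<integral>\<^sup>+\<xi>. \<integral>\<^sup>+\<eta>. ?G \<xi> * ?P \<xi> \<eta> \<partial>lborel \<partial>lborel) +
      (\<integral>\<^sup>+\<xi>. \<integral>\<^sup>+\<eta>. ?G \<eta> * ?P \<xi> \<eta> \<partial>lborel \<partial>lborel)"
    by (simp add: nn_integral_add)
  also have "(\<integral>\<^sup>+\<xi>. \<integral>\<^sup>+\<eta>. ?G \<xi> * ?P \<xi> \<eta> \<partial>lborel \<partial>lborel) = (\<integral>\<^sup>+\<xi>. ?G \<xi> \<partial>lborel)"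
    by (simp add: nn_integral_cmult P2)
  also have "(\<integral>\<^sup>+\<xi>. \<integral>\<^sup>+\<eta>. ?G \<eta> * ?P \<xi> \<eta> \<partial>lborel \<partial>lborel) =
      (\<integral>\<^sup>+\<eta>. \<integral>\<^sup>+\<xi>. ?G \<eta> * ?P \<xi> \<eta> \<partial>lborel \<partial>lborel)"
    by (rule lborel_pair.Fubini'[symmetric]) measurable
  also have "\<dots> = (\<integral>\<^sup>+\<xi>. ?G \<xi> \<partial>lborel)"
    by (simp add: nn_integral_cmult P1)
  also have "(\<integral>\<^sup>+\<xi>. ?G \<xi> \<partial>lborel) + (\<integral>\<^sup>+\<xi>. ?G \<xi> \<partial>lborel) = ?R"
    by (subst nn_integral_add[symmetric]) (simp_all flip: ennreal_plus)
  finally show ?thesis .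
qed

text \<open>The Gaussian weight makes the triple integral in \<open>x\<close>, \<open>\<xi>\<close>, \<open>\<eta>\<close> obtained by expanding the square
absolutely convergent. Integrating in \<open>x\<close> first turns the weight into a Gaussian density in
\<open>\<xi> - \<eta>\<close>, and convolution with that density does not increase the \<open>L\<^sup>2\<close> norm.\<close>

lemma weighted_plancherel_le:
  fixes g :: "'a::euclidean_space \<Rightarrow> complex"
  assumes g: "integrable lborel g" and \<sigma>: "\<sigma> > 0"
  shows "(\<integral>\<^sup>+x. ennreal (gauss_weight \<sigma> x * (norm (fourier_integral g x))\<^sup>2) \<partial>lborel) \<le>
    ennreal ((2 * pi) ^ DIM('a)) * (\<integral>\<^sup>+\<xi>. ennreal ((norm (g \<xi>))\<^sup>2) \<partial>lborel)"
proof -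
  have [measurable]: "g \<in> borel_measurable lborel" using g by simp
  define h where "h = (\<lambda>p. g (fst p) * cnj (g (snd p)))"
  define W where "W = (\<lambda>x::'a. complex_of_real (gauss_weight \<sigma> x))"
  have h: "integrable lborel h"
    using integrable_lborel_tensor[OF g integrable_cnj[OF g]]
    by (simp add: h_def lborel_prod case_prod_beta')
  have W: "integrable lborel W"
    using integrable.intros[OF has_bochner_integral_cis_gauss_weight[OF \<sigma>, of "0::'a"]] by (simp add: W_def)
  have [measurable]: "h \<in> borel_measurable lborel" "W \<in> borel_measurable lborel"
    using h W by simp_all
  have [measurable]: "(\<lambda>p::'a \<times> 'a. fst p - snd p) \<in> borel_measurable borel"
    by (intro borel_measurable_continuous_onI continuous_intros)
  \<comment> \<open>The pair \<open>p\<close> of frequencies is a single variable, so that Fubini applies to two factors only.\<close>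
  let ?k = "\<lambda>x p. cis (x \<bullet> (fst p - snd p)) * W x * h p"
  have k: "integrable (lborel \<Otimes>\<^sub>M lborel) (\<lambda>(x, p). ?k x p)"
    by (rule Bochner_Integration.integrable_bound[OF integrable_lborel_tensor[OF W h]])
      (auto simp: norm_mult)
  have sq: "complex_of_real (gauss_weight \<sigma> x * (norm (fourier_integral g x))\<^sup>2) = (LINT p|lborel. ?k x p)" for x
  proof -
    let ?a = "\<lambda>\<xi>. cis (x \<bullet> \<xi>) * g \<xi>"
    have a: "integrable lborel ?a" by (rule integrable_cis_mult[OF g])
    have "integrable (lborel \<Otimes>\<^sub>M lborel) (\<lambda>(\<xi>, \<eta>). ?a \<xi> * cnj (?a \<eta>))"
      by (rule integrable_lborel_tensor) (use a integrable_cnj[OF a] in simp_all)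
    note prod = lborel_pair.integral_fst[OF this]
    have "complex_of_real ((norm (fourier_integral g x))\<^sup>2) =
        (LINT \<xi>|lborel. ?a \<xi>) * (LINT \<eta>|lborel. cnj (?a \<eta>))"
      by (simp only: complex_norm_square fourier_integral_def Bochner_Integration.integral_cnj)
    also have "\<dots> = (LINT \<xi>|lborel. LINT \<eta>|lborel. ?a \<xi> * cnj (?a \<eta>))"
      by simp
    also have "\<dots> = (LINT p|lborel. cis (x \<bullet> (fst p - snd p)) * h p)"
      unfolding prod lborel_prod
      by (intro Bochner_Integration.integral_cong refl)
        (simp add: h_def case_prod_beta' inner_diff_right cis_cnj cis_mult mult_ac
          flip: cis_mult[of "x \<bullet> _" "- (x \<bullet> _)"])
    finally have "complex_of_real (gauss_weight \<sigma> x * (norm (fourier_integral g x))\<^sup>2) =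
        W x * (LINT p|lborel. cis (x \<bullet> (fst p - snd p)) * h p)"
      by (simp only: W_def of_real_mult)
    also have "\<dots> = (LINT p|lborel. W x * (cis (x \<bullet> (fst p - snd p)) * h p))"
      by simp
    finally show ?thesis
      by (simp only: mult_ac)
  qed
  note weight = has_bochner_integral_integral_eq[OF has_bochner_integral_cis_gauss_weight[OF \<sigma>]]
  have sq_int: "integrable lborel (\<lambda>x. LINT p|lborel. ?k x p)"
    using lborel_pair.integrable_fst[OF k] .
  have int: "integrable lborel (\<lambda>x. gauss_weight \<sigma> x * (norm (fourier_integral g x))\<^sup>2)"
    using sq_int unfolding sq[symmetric] complex_of_real_integrable_eq .
  have "complex_of_real (LINT x|lborel. gauss_weight \<sigma> x * (norm (fourier_integral g x))\<^sup>2) =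
      (LINT x|lborel. LINT p|lborel. ?k x p)"
    by (simp only: sq[symmetric] integral_complex_of_real)
  also have "\<dots> = (LINT p|lborel. LINT x|lborel. ?k x p)"
    using lborel_pair.Fubini_integral[OF k] by simp
  also have "\<dots> = (LINT p|lborel. of_real ((2 * pi) ^ DIM('a) * gauss_density (1 / \<sigma>) (fst p - snd p)) * h p)"
    by (simp only: W_def integral_mult_left_zero weight)
  finally have eq: "complex_of_real (LINT x|lborel. gauss_weight \<sigma> x * (norm (fourier_integral g x))\<^sup>2) = \<dots>" .
  have k': "integrable lborel (\<lambda>p. of_real ((2 * pi) ^ DIM('a) * gauss_density (1 / \<sigma>) (fst p - snd p)) * h p)"
    using lborel_pair.integrable_snd[OF k]
    by (simp only: W_def integral_mult_left_zero weight)
  have "(\<integral>\<^sup>+x. ennreal (gauss_weight \<sigma> x * (norm (fourier_integral g x))\<^sup>2) \<partial>lborel) =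
      ennreal (LINT x|lborel. gauss_weight \<sigma> x * (norm (fourier_integral g x))\<^sup>2)"
    by (intro nn_integral_eq_integral int) (simp add: less_imp_le[OF gauss_weight_pos])
  also have "\<dots> \<le> ennreal (norm (complex_of_real (LINT x|lborel. gauss_weight \<sigma> x * (norm (fourier_integral g x))\<^sup>2)))"
    by (intro ennreal_leI) simp
  also have "\<dots> \<le> (\<integral>\<^sup>+p. norm (of_real ((2 * pi) ^ DIM('a) * gauss_density (1 / \<sigma>) (fst p - snd p)) * h p) \<partial>lborel)"
    unfolding eq by (rule integral_norm_bound_ennreal[OF k'])
  also have "\<dots> = (\<integral>\<^sup>+p. ennreal ((2 * pi) ^ DIM('a)) *
      (case p of (\<xi>, \<eta>) \<Rightarrow> ennreal (norm (g \<xi>) * norm (g \<eta>) * gauss_density (1 / \<sigma>) (\<xi> - \<eta>))) \<partial>lborel)"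
    by (intro nn_integral_cong)
      (auto simp: h_def norm_mult gauss_density_nonneg abs_mult norm_power mult_ac simp flip: ennreal_mult)
  also have "\<dots> = ennreal ((2 * pi) ^ DIM('a)) *
      (\<integral>\<^sup>+\<xi>. \<integral>\<^sup>+\<eta>. ennreal (norm (g \<xi>) * norm (g \<eta>) * gauss_density (1 / \<sigma>) (\<xi> - \<eta>)) \<partial>lborel \<partial>lborel)"
    unfolding lborel_prod[symmetric]
    by (subst nn_integral_cmult) (simp_all add: lborel.nn_integral_fst[symmetric])
  also have "\<dots> \<le> ennreal ((2 * pi) ^ DIM('a)) * (\<integral>\<^sup>+\<xi>. ennreal ((norm (g \<xi>))\<^sup>2) \<partial>lborel)"
    using \<sigma> by (intro mult_left_mono nn_integral_gauss_convolution_le) auto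
  finally show ?thesis .
qed

text \<open>The weights with parameter \<open>Suc n\<close> tend to one pointwise, and the bound for them does not depend
on \<open>n\<close>.\<close>

lemma plancherel_le:
  fixes g :: "'a::euclidean_space \<Rightarrow> complex"
  assumes g: "integrable lborel g"
  shows "(\<integral>\<^sup>+x. ennreal ((norm (fourier_integral g x))\<^sup>2) \<partial>lborel) \<le>
    ennreal ((2 * pi) ^ DIM('a)) * (\<integral>\<^sup>+\<xi>. ennreal ((norm (g \<xi>))\<^sup>2) \<partial>lborel)"
proof (rule nn_integral_le_AE_limit)
  have [measurable]: "g \<in> borel_measurable lborel" using g by simp
  let ?u = "\<lambda>n x. ennreal (gauss_weight (Suc n) x * (norm (fourier_integral g x))\<^sup>2)"
  show "?u n \<in> borel_measurable lborel" for n by measurable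
  show "(\<integral>\<^sup>+x. ?u n x \<partial>lborel) \<le>
      ennreal ((2 * pi) ^ DIM('a)) * (\<integral>\<^sup>+\<xi>. ennreal ((norm (g \<xi>))\<^sup>2) \<partial>lborel)" for n
    by (rule weighted_plancherel_le[OF g]) simp
  have e: "(\<lambda>n. exp (- s\<^sup>2 / (2 * (real (Suc n))\<^sup>2))) \<longlonglongrightarrow> exp 0" for s :: real
  proof (intro tendsto_exp)
    have "(\<lambda>n. - s\<^sup>2 / 2 * (inverse (real (Suc n)))\<^sup>2) \<longlonglongrightarrow> - s\<^sup>2 / 2 * 0\<^sup>2"
      by (rule tendsto_mult[OF tendsto_const tendsto_power[OF LIMSEQ_inverse_real_of_nat]])
    moreover have "- s\<^sup>2 / (2 * a\<^sup>2) = - s\<^sup>2 / 2 * (inverse a)\<^sup>2" for a :: real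
      by (cases "a = 0") (simp_all add: field_simps)
    ultimately show "(\<lambda>n. - s\<^sup>2 / (2 * (real (Suc n))\<^sup>2)) \<longlonglongrightarrow> 0"
      by (simp only: power_zero_numeral mult_zero_right)
  qed
  have "(\<lambda>n. gauss_weight (Suc n) x) \<longlonglongrightarrow> (\<Prod>b\<in>(Basis::'a set). exp 0)" for x :: 'a
    unfolding gauss_weight_def by (intro tendsto_prod e)
  then have "(\<lambda>n. gauss_weight (Suc n) x) \<longlonglongrightarrow> 1" for x :: 'a by simp
  then have "(\<lambda>n. ?u n x) \<longlonglongrightarrow> ennreal (1 * (norm (fourier_integral g x))\<^sup>2)" for x
    by (intro tendsto_ennrealI tendsto_mult tendsto_const)
  then show "AE x in lborel. (\<lambda>n. ?u n x) \<longlonglongrightarrow> ennreal ((norm (fourier_integral g x))\<^sup>2)"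
    by simp
qed

section \<open>The Fourier transform on \<open>L\<^sup>2\<close>\<close>

lemma fourier_integral_diff:
  fixes f g :: "'a::euclidean_space \<Rightarrow> complex"
  assumes "integrable lborel f" "integrable lborel g"
  shows "fourier_integral (\<lambda>\<xi>. f \<xi> - g \<xi>) x = fourier_integral f x - fourier_integral g x"
  unfolding fourier_integral_def
  by (simp add: right_diff_distrib integrable_cis_mult assms)

lemma square_add_le: "(a + b)\<^sup>2 \<le> 2 * a\<^sup>2 + 2 * b\<^sup>2" for a b :: real
  using sum_squares_bound[of a b] by (simp add: power2_sum)

lemma integrable_norm_square_fourier_integral:
  fixes g :: "'a::euclidean_space \<Rightarrow> complex"
  assumes g: "integrable lborel g" and g2: "integrable lborel (\<lambda>\<xi>. (norm (g \<xi>))\<^sup>2)"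
  shows "integrable lborel (\<lambda>x. (norm (fourier_integral g x))\<^sup>2)"
proof (rule integrableI_bounded)
  have [measurable]: "g \<in> borel_measurable lborel" using g by simp
  show "(\<lambda>x. (norm (fourier_integral g x))\<^sup>2) \<in> borel_measurable lborel" by measurable
  have "(\<integral>\<^sup>+\<xi>. ennreal ((norm (g \<xi>))\<^sup>2) \<partial>lborel) < \<infinity>"
    using g2 by (simp add: integrable_iff_bounded)
  then have "ennreal ((2 * pi) ^ DIM('a)) * (\<integral>\<^sup>+\<xi>. ennreal ((norm (g \<xi>))\<^sup>2) \<partial>lborel) < \<infinity>"
    by (simp add: ennreal_mult_less_top)
  with plancherel_le[OF g]
  show "(\<integral>\<^sup>+x. ennreal (norm ((norm (fourier_integral g x))\<^sup>2)) \<partial>lborel) < \<infinity>"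
    by (simp add: le_less_trans)
qed

text \<open>Geometric decay of the truncation error makes the transforms of the truncated functions converge
almost everywhere, with an \<open>L\<^sup>2\<close> majorant, and not only in the mean. Radii tending to infinity make
the truncations themselves converge pointwise.\<close>

lemma rapid_truncation:
  fixes G :: "'a::euclidean_space \<Rightarrow> complex"
  assumes [measurable]: "G \<in> borel_measurable lborel"
    and G2: "integrable lborel (\<lambda>\<xi>. (norm (G \<xi>))\<^sup>2)"
  obtains r :: "nat \<Rightarrow> nat" where "\<And>k. k \<le> r k"
    and "\<And>k. (\<integral>\<^sup>+\<xi>. ennreal (indicator {\<xi>. real (r k) < norm \<xi>} \<xi> * (norm (G \<xi>))\<^sup>2) \<partial>lborel) \<le> ennreal ((1 / 8) ^ k)"
proof -
  let ?t = "\<lambda>r \<xi>. indicator {\<xi>. real r < norm \<xi>} \<xi> * (norm (G \<xi>))\<^sup>2"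
  have int: "integrable lborel (?t r)" for r
    by (rule Bochner_Integration.integrable_bound[OF G2]) (auto split: split_indicator)
  have "(\<lambda>r. LINT \<xi>|lborel. ?t r \<xi>) \<longlonglongrightarrow> (LINT \<xi>|(lborel::'a measure). (0::real))"
  proof (rule integral_dominated_convergence[OF _ _ G2])
    have "eventually (\<lambda>r. ?t r \<xi> = 0) sequentially" for \<xi>
    proof -
      obtain m where "norm \<xi> \<le> real m" using real_arch_simple by blast
      then show ?thesis
        by (intro eventually_sequentiallyI[of m]) (auto split: split_indicator)
    qed
    then show "AE \<xi> in lborel. (\<lambda>r. ?t r \<xi>) \<longlonglongrightarrow> 0"
      by (intro AE_I2 tendsto_eventually)
  qed (auto split: split_indicator)
  then have lim: "(\<lambda>r. LINT \<xi>|lborel. ?t r \<xi>) \<longlonglongrightarrow> 0" by simp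
  have "\<exists>r\<ge>k. (LINT \<xi>|lborel. ?t r \<xi>) \<le> (1 / 8) ^ k" for k
  proof -
    have "eventually (\<lambda>r. (LINT \<xi>|lborel. ?t r \<xi>) < (1 / 8) ^ k) sequentially"
      by (rule order_tendstoD(2)[OF lim]) simp
    then have "eventually (\<lambda>r. k \<le> r \<and> (LINT \<xi>|lborel. ?t r \<xi>) < (1 / 8) ^ k) sequentially"
      using eventually_ge_at_top by (rule eventually_conj[rotated])
    from eventually_happens'[OF sequentially_bot this] show ?thesis
      by (auto intro: less_imp_le)
  qed
  then have "\<exists>r. \<forall>k. k \<le> r k \<and> (LINT \<xi>|lborel. ?t (r k) \<xi>) \<le> (1 / 8) ^ k"
    by (intro choice) blast
  then obtain r where r: "\<And>k. k \<le> r k" "\<And>k. (LINT \<xi>|lborel. ?t (r k) \<xi>) \<le> (1 / 8) ^ k"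
    by blast
  show thesis
  proof (rule that[of r])
    show "(\<integral>\<^sup>+\<xi>. ennreal (?t (r k) \<xi>) \<partial>lborel) \<le> ennreal ((1 / 8) ^ k)" for k
      using ennreal_leI[OF r(2)[of k]] by (subst nn_integral_eq_integral[OF int]) auto
  qed (rule r(1))
qed

text \<open>A quantitative form of the completeness of \<open>L\<^sup>2\<close>. One square integrable function \<open>W\<close> bounds all
increments by \<open>norm (H (Suc k) x - H k x) \<le> W x * (1 / 2) ^ k\<close>, so the sequence converges almost
everywhere and \<open>norm (H 0 x) + 2 * W x\<close> is a common majorant, as dominated convergence requires.\<close>

lemma rapidly_Cauchy_L2_limit:
  fixes H :: "nat \<Rightarrow> 'a \<Rightarrow> 'b::{banach, second_countable_topology}"
  assumes [measurable]: "\<And>k. H k \<in> borel_measurable M"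
    and H0: "integrable M (\<lambda>x. (norm (H 0 x))\<^sup>2)"
    and c: "c \<ge> 0"
    and step: "\<And>k. (\<integral>\<^sup>+x. ennreal ((norm (H (Suc k) x - H k x))\<^sup>2) \<partial>M) \<le> ennreal (c * (1 / 8) ^ k)"
  obtains h w where "h \<in> borel_measurable M" and "w \<in> borel_measurable M"
    and "integrable M (\<lambda>x. (w x)\<^sup>2)"
    and "AE x in M. (\<lambda>k. H k x) \<longlonglongrightarrow> h x"
    and "AE x in M. \<forall>k. norm (H k x) \<le> w x"
proof -
  \<comment> \<open>The weights \<open>4 ^ k\<close> are still beaten by the decay \<open>(1 / 8) ^ k\<close>, and each single term of the
    series bounds the corresponding increment by \<open>W x * (1 / 2) ^ k\<close>.\<close>
  define q where "q x = (\<Sum>k. ennreal (4 ^ k * (norm (H (Suc k) x - H k x))\<^sup>2))" for x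
  have [measurable]: "q \<in> borel_measurable M"
    unfolding q_def by measurable
  have "(\<integral>\<^sup>+x. q x \<partial>M) = (\<Sum>k. \<integral>\<^sup>+x. ennreal (4 ^ k * (norm (H (Suc k) x - H k x))\<^sup>2) \<partial>M)"
    unfolding q_def by (rule nn_integral_suminf) measurable
  also have "\<dots> \<le> (\<Sum>k. ennreal (c * (1 / 2) ^ k))"
  proof (intro suminf_le summableI)
    fix k
    have four_eighth: "4 ^ k * (c * (1 / 8) ^ k) = c * (1 / 2) ^ k"
      using power_mult_distrib[of "4::real" "1 / 8" k] by simp
    have "(\<integral>\<^sup>+x. ennreal (4 ^ k * (norm (H (Suc k) x - H k x))\<^sup>2) \<partial>M) =
        ennreal (4 ^ k) * (\<integral>\<^sup>+x. ennreal ((norm (H (Suc k) x - H k x))\<^sup>2) \<partial>M)"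
      by (simp add: nn_integral_cmult ennreal_mult)
    also have "\<dots> \<le> ennreal (4 ^ k) * ennreal (c * (1 / 8) ^ k)"
      by (intro mult_left_mono step) simp
    also have "\<dots> = ennreal (c * (1 / 2) ^ k)"
      using four_eighth c by (subst ennreal_mult[symmetric]) simp_all
    finally show "(\<integral>\<^sup>+x. ennreal (4 ^ k * (norm (H (Suc k) x - H k x))\<^sup>2) \<partial>M) \<le> ennreal (c * (1 / 2) ^ k)" .
  qed
  also have "\<dots> < \<infinity>"
    using c by (subst suminf_ennreal2) (auto intro!: summable_mult summable_geometric)
  finally have q_int: "(\<integral>\<^sup>+x. q x \<partial>M) < \<infinity>" .
  define W where "W x = sqrt (enn2real (q x))" for x
  have [measurable]: "W \<in> borel_measurable M"
    unfolding W_def by measurable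
  have W2: "integrable M (\<lambda>x. (W x)\<^sup>2)"
  proof (rule integrableI_bounded)
    have "(\<integral>\<^sup>+x. ennreal (norm ((W x)\<^sup>2)) \<partial>M) \<le> (\<integral>\<^sup>+x. q x \<partial>M)"
      by (intro nn_integral_mono) (simp add: W_def ennreal_enn2real_if)
    with q_int show "(\<integral>\<^sup>+x. ennreal (norm ((W x)\<^sup>2)) \<partial>M) < \<infinity>" by simp
  qed simp
  have finite_q: "AE x in M. q x \<noteq> \<infinity>"
    using q_int by (intro nn_integral_PInf_AE) auto
  have f_le: "norm (H (Suc k) x - H k x) \<le> W x * (1 / 2) ^ k" if "q x \<noteq> \<infinity>" for x k
  proof (rule power2_le_imp_le)
    have "ennreal (4 ^ k * (norm (H (Suc k) x - H k x))\<^sup>2) \<le> q x"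
    proof -
      let ?f = "\<lambda>k. ennreal (4 ^ k * (norm (H (Suc k) x - H k x))\<^sup>2)"
      have "?f k = sum ?f {k}" by simp
      also have "\<dots> \<le> suminf ?f" by (intro sum_le_suminf summableI) auto
      finally show ?thesis by (simp only: q_def)
    qed
    also have "q x = ennreal (enn2real (q x))"
      using that by (simp add: less_top)
    finally have "4 ^ k * (norm (H (Suc k) x - H k x))\<^sup>2 \<le> enn2real (q x)"
      by (simp only: ennreal_le_iff[OF enn2real_nonneg])
    also have "\<dots> = (W x)\<^sup>2" by (simp add: W_def)
    finally have le: "4 ^ k * (norm (H (Suc k) x - H k x))\<^sup>2 \<le> (W x)\<^sup>2" .
    show "(norm (H (Suc k) x - H k x))\<^sup>2 \<le> (W x * (1 / 2) ^ k)\<^sup>2"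
    proof -
      have "((1 / 2 :: real) ^ k)\<^sup>2 = ((1 / 2)\<^sup>2) ^ k"
        by (simp only: power_mult[symmetric] mult.commute)
      then have eq: "(W x * (1 / 2) ^ k)\<^sup>2 = (1 / 4) ^ k * (W x)\<^sup>2"
        by (simp only: power_mult_distrib) (simp add: power2_eq_square)
      have "(norm (H (Suc k) x - H k x))\<^sup>2 = (1 / 4) ^ k * (4 ^ k * (norm (H (Suc k) x - H k x))\<^sup>2)"
        by (simp add: power_divide)
      also have "\<dots> \<le> (1 / 4) ^ k * (W x)\<^sup>2"
        by (intro mult_left_mono le) simp
      finally show ?thesis unfolding eq .
    qed
    show "0 \<le> W x * (1 / 2) ^ k" by (simp add: W_def)
  qed
  have telescope: "H k x = H 0 x + (\<Sum>j<k. H (Suc j) x - H j x)" for k x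
    using sum_lessThan_telescope[of "\<lambda>j. H j x" k] by simp
  have H_le: "norm (H k x) \<le> norm (H 0 x) + 2 * W x" if "q x \<noteq> \<infinity>" for x k
  proof -
    have W0: "W x \<ge> 0" by (simp add: W_def)
    have "norm (\<Sum>j<k. H (Suc j) x - H j x) \<le> (\<Sum>j<k. W x * (1 / 2) ^ j)"
      by (intro order_trans[OF norm_sum] sum_mono f_le that)
    also have "\<dots> = W x * (\<Sum>j<k. (1 / 2) ^ j)" by (simp add: sum_distrib_left)
    also have "\<dots> \<le> W x * 2"
      using W0 by (intro mult_left_mono) (simp_all add: geometric_sum)
    finally show ?thesis
      using norm_triangle_ineq[of "H 0 x" "\<Sum>j<k. H (Suc j) x - H j x"] telescope[of k x] by simp
  qed
  define h where "h x = lim (\<lambda>k. H k x)" for x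
  have [measurable]: "h \<in> borel_measurable M"
    unfolding h_def by (rule borel_measurable_lim_metric) simp
  have lim: "AE x in M. (\<lambda>k. H k x) \<longlonglongrightarrow> h x"
    using finite_q
  proof eventually_elim
    case (elim x)
    have "summable (\<lambda>k. H (Suc k) x - H k x)"
      by (rule summable_comparison_test'[where N = 0 and g = "\<lambda>k. W x * (1 / 2) ^ k"])
        (auto intro!: summable_mult summable_geometric f_le elim)
    then have "(\<lambda>k. H 0 x + (\<Sum>j<k. H (Suc j) x - H j x)) \<longlonglongrightarrow> H 0 x + (\<Sum>j. H (Suc j) x - H j x)"
      by (intro tendsto_intros summable_LIMSEQ)
    then have "convergent (\<lambda>k. H k x)"
      unfolding telescope[symmetric] by (rule convergentI)
    then show ?case
      unfolding h_def by (simp add: convergent_LIMSEQ_iff)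
  qed
  show thesis
  proof
    show "(\<lambda>x. norm (H 0 x) + 2 * W x) \<in> borel_measurable M" by simp
    show "integrable M (\<lambda>x. (norm (H 0 x) + 2 * W x)\<^sup>2)"
    proof (rule Bochner_Integration.integrable_bound)
      show "integrable M (\<lambda>x. 2 * (norm (H 0 x))\<^sup>2 + 8 * (W x)\<^sup>2)"
        using H0 W2 by simp
      show "AE x in M. norm ((norm (H 0 x) + 2 * W x)\<^sup>2) \<le> norm (2 * (norm (H 0 x))\<^sup>2 + 8 * (W x)\<^sup>2)"
        using square_add_le[of "norm (H 0 _)" "2 * W _"] by (simp add: power_mult_distrib)
    qed simp
    show "AE x in M. \<forall>k. norm (H k x) \<le> norm (H 0 x) + 2 * W x"
      using finite_q by eventually_elim (use H_le in blast)
  qed (use lim in simp_all)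
qed

text \<open>For \<open>G\<close> in \<open>L\<^sup>2\<close> the Fourier integral need not converge. It is replaced by the limit of the transforms
\<open>H k\<close> of truncations \<open>Gk k\<close> to balls, which are integrable. By the Plancherel inequality the increments
of \<open>H\<close> inherit the geometric decay of the truncation errors. The norm bound
passes to the limit by Fatou's lemma and the duality relation by dominated convergence.\<close>

lemma L2_fourier_transform_exists:
  fixes G :: "'a::euclidean_space \<Rightarrow> complex"
  assumes [measurable]: "G \<in> borel_measurable lborel"
    and G2: "integrable lborel (\<lambda>\<xi>. (norm (G \<xi>))\<^sup>2)"
  obtains h where "h \<in> borel_measurable lborel"
    and "(\<integral>\<^sup>+x. ennreal ((norm (h x))\<^sup>2) \<partial>lborel) \<le>
      ennreal ((2 * pi) ^ DIM('a)) * (\<integral>\<^sup>+\<xi>. ennreal ((norm (G \<xi>))\<^sup>2) \<partial>lborel)"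
    and "\<And>\<phi>. integrable lborel \<phi> \<Longrightarrow> integrable lborel (\<lambda>x. (norm (\<phi> x))\<^sup>2) \<Longrightarrow>
      (LINT x|lborel. h x * \<phi> x) = (LINT \<xi>|lborel. G \<xi> * fourier_integral \<phi> \<xi>)"
proof -
  let ?c = "(2 * pi) ^ DIM('a)"
  obtain r where rk: "\<And>k. k \<le> r k"
    and tail: "\<And>k. (\<integral>\<^sup>+\<xi>. ennreal (indicator {\<xi>. real (r k) < norm \<xi>} \<xi> * (norm (G \<xi>))\<^sup>2) \<partial>lborel) \<le> ennreal ((1 / 8) ^ k)"
    using rapid_truncation[OF assms] by blast
  define Gk where "Gk k \<xi> = (if norm \<xi> \<le> real (r k) then G \<xi> else 0)" for k \<xi>
  have [measurable]: "Gk k \<in> borel_measurable lborel" for k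
    unfolding Gk_def by measurable
  have Gk_le: "norm (Gk k \<xi>) \<le> norm (G \<xi>)" for k \<xi>
    by (simp add: Gk_def)
  have Gk: "integrable lborel (Gk k)" for k
  proof (rule Bochner_Integration.integrable_bound)
    show "integrable lborel (\<lambda>\<xi>. indicator (cball 0 (real (r k))) \<xi> + (norm (G \<xi>))\<^sup>2)"
      using G2 emeasure_lborel_cball_finite[of "0::'a" "real (r k)"]
      by (intro Bochner_Integration.integrable_add integrable_real_indicator) auto
    have "a \<le> 1 + a\<^sup>2" for a :: real
    proof -
      have "2 * a \<le> a\<^sup>2 + 1" using sum_squares_bound[of a 1] by simp
      then show ?thesis using zero_le_power2[of a] by linarith
    qed
    then show "AE \<xi> in lborel. norm (Gk k \<xi>) \<le> norm (indicator (cball 0 (real (r k))) \<xi> + (norm (G \<xi>))\<^sup>2)"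
      by (auto simp: Gk_def)
  qed simp
  define H where "H k = fourier_integral (Gk k)" for k
  have [measurable]: "H k \<in> borel_measurable lborel" for k
    unfolding H_def by measurable
  have Gk2: "integrable lborel (\<lambda>\<xi>. (norm (Gk k \<xi>))\<^sup>2)" for k
    by (rule Bochner_Integration.integrable_bound[OF G2]) (auto intro!: power_mono Gk_le)
  have H0: "integrable lborel (\<lambda>x. (norm (H 0 x))\<^sup>2)"
    unfolding H_def by (rule integrable_norm_square_fourier_integral[OF Gk Gk2])
  have step: "(\<integral>\<^sup>+x. ennreal ((norm (H (Suc k) x - H k x))\<^sup>2) \<partial>lborel) \<le> ennreal (?c * (2 * (1 / 8) ^ k))" for k
  proof -
    let ?d = "\<lambda>\<xi>. Gk (Suc k) \<xi> - Gk k \<xi>"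
    let ?t = "\<lambda>k \<xi>. indicator {\<xi>. real (r k) < norm \<xi>} \<xi> * (norm (G \<xi>))\<^sup>2"
    have "(\<integral>\<^sup>+\<xi>. ennreal ((norm (?d \<xi>))\<^sup>2) \<partial>lborel) \<le> (\<integral>\<^sup>+\<xi>. ennreal (?t (Suc k) \<xi>) + ennreal (?t k \<xi>) \<partial>lborel)"
      by (intro nn_integral_mono) (auto simp: Gk_def simp flip: ennreal_plus split: split_indicator)
    also have "\<dots> = (\<integral>\<^sup>+\<xi>. ennreal (?t (Suc k) \<xi>) \<partial>lborel) + (\<integral>\<^sup>+\<xi>. ennreal (?t k \<xi>) \<partial>lborel)"
      by (rule nn_integral_add) measurable
    also have "\<dots> \<le> ennreal ((1 / 8) ^ Suc k) + ennreal ((1 / 8) ^ k)"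
      by (intro add_mono tail)
    also have "\<dots> \<le> ennreal (2 * (1 / 8) ^ k)"
      by (subst ennreal_plus[symmetric]) (auto intro!: ennreal_leI)
    finally have "(\<integral>\<^sup>+\<xi>. ennreal ((norm (?d \<xi>))\<^sup>2) \<partial>lborel) \<le> ennreal (2 * (1 / 8) ^ k)" .
    then have "ennreal ?c * (\<integral>\<^sup>+\<xi>. ennreal ((norm (?d \<xi>))\<^sup>2) \<partial>lborel) \<le> ennreal (?c * (2 * (1 / 8) ^ k))"
      by (subst ennreal_mult) (auto intro!: mult_left_mono)
    with plancherel_le[OF Bochner_Integration.integrable_diff[OF Gk[of "Suc k"] Gk[of k]]]
    show ?thesis
      by (simp add: H_def fourier_integral_diff[OF Gk Gk] del: power_Suc)
  qed
  have step': "(\<integral>\<^sup>+x. ennreal ((norm (H (Suc k) x - H k x))\<^sup>2) \<partial>lborel) \<le> ennreal (2 * ?c * (1 / 8) ^ k)" for k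
    using step[of k] by (simp only: mult_ac)
  obtain h w where [measurable]: "h \<in> borel_measurable lborel" "w \<in> borel_measurable lborel"
    and w2: "integrable lborel (\<lambda>x. (w x)\<^sup>2)"
    and lim: "AE x in lborel. (\<lambda>k. H k x) \<longlonglongrightarrow> h x"
    and H_le: "AE x in lborel. \<forall>k. norm (H k x) \<le> w x"
    using rapidly_Cauchy_L2_limit[OF _ H0 _ step'] by auto
  show thesis
  proof
    show "h \<in> borel_measurable lborel" by simp
    show "(\<integral>\<^sup>+x. ennreal ((norm (h x))\<^sup>2) \<partial>lborel) \<le> ennreal ?c * (\<integral>\<^sup>+\<xi>. ennreal ((norm (G \<xi>))\<^sup>2) \<partial>lborel)"
    proof (rule nn_integral_le_AE_limit[where u = "\<lambda>k x. ennreal ((norm (H k x))\<^sup>2)"])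
      show "AE x in lborel. (\<lambda>k. ennreal ((norm (H k x))\<^sup>2)) \<longlonglongrightarrow> ennreal ((norm (h x))\<^sup>2)"
        using lim by eventually_elim (intro tendsto_intros)
      fix k
      have "(\<integral>\<^sup>+x. ennreal ((norm (H k x))\<^sup>2) \<partial>lborel) \<le> ennreal ?c * (\<integral>\<^sup>+\<xi>. ennreal ((norm (Gk k \<xi>))\<^sup>2) \<partial>lborel)"
        unfolding H_def by (rule plancherel_le[OF Gk])
      also have "\<dots> \<le> ennreal ?c * (\<integral>\<^sup>+\<xi>. ennreal ((norm (G \<xi>))\<^sup>2) \<partial>lborel)"
        by (intro mult_left_mono nn_integral_mono ennreal_leI power_mono Gk_le) auto
      finally show "(\<integral>\<^sup>+x. ennreal ((norm (H k x))\<^sup>2) \<partial>lborel) \<le> \<dots>" .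
    qed simp
    fix \<phi> :: "'a \<Rightarrow> complex"
    assume \<phi>: "integrable lborel \<phi>" and \<phi>2: "integrable lborel (\<lambda>x. (norm (\<phi> x))\<^sup>2)"
    have [measurable]: "\<phi> \<in> borel_measurable lborel" using \<phi> by simp
    have ab: "norm (a * b) \<le> (norm a)\<^sup>2 + (norm b)\<^sup>2" for a b :: complex
    proof -
      have "0 \<le> norm a * norm b" by simp
      then show ?thesis
        using sum_squares_bound[of "norm a" "norm b"] unfolding norm_mult by linarith
    qed
    have "(\<lambda>k. LINT x|lborel. H k x * \<phi> x) \<longlonglongrightarrow> (LINT x|lborel. h x * \<phi> x)"
    proof (rule integral_dominated_convergence)
      show "integrable lborel (\<lambda>x. (w x)\<^sup>2 + (norm (\<phi> x))\<^sup>2)"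
        using w2 \<phi>2 by simp
      show "AE x in lborel. (\<lambda>k. H k x * \<phi> x) \<longlonglongrightarrow> h x * \<phi> x"
        using lim by eventually_elim (intro tendsto_intros)
      fix k
      show "AE x in lborel. norm (H k x * \<phi> x) \<le> (w x)\<^sup>2 + (norm (\<phi> x))\<^sup>2"
        using H_le
      proof eventually_elim
        case (elim x)
        then have "(norm (H k x))\<^sup>2 \<le> (w x)\<^sup>2"
          by (intro power_mono) auto
        then show ?case
          using ab[of "H k x" "\<phi> x"] by simp
      qed
    qed simp_all
    moreover have "(LINT x|lborel. H k x * \<phi> x) = (LINT \<xi>|lborel. Gk k \<xi> * fourier_integral \<phi> \<xi>)" for k
      unfolding H_def by (rule fourier_integral_duality[OF Gk \<phi>, symmetric])
    moreover have "(\<lambda>k. LINT \<xi>|lborel. Gk k \<xi> * fourier_integral \<phi> \<xi>) \<longlonglongrightarrow> (LINT \<xi>|lborel. G \<xi> * fourier_integral \<phi> \<xi>)"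
    proof (rule integral_dominated_convergence)
      show "integrable lborel (\<lambda>\<xi>. (norm (G \<xi>))\<^sup>2 + (norm (fourier_integral \<phi> \<xi>))\<^sup>2)"
        using G2 integrable_norm_square_fourier_integral[OF \<phi> \<phi>2] by simp
      have "eventually (\<lambda>k. Gk k \<xi> = G \<xi>) sequentially" for \<xi>
      proof -
        obtain m where "norm \<xi> \<le> real m" using real_arch_simple by blast
        then have "Gk k \<xi> = G \<xi>" if "k \<ge> m" for k
          using rk[of k] that by (simp add: Gk_def)
        then show ?thesis by (rule eventually_sequentiallyI)
      qed
      then have "(\<lambda>k. Gk k \<xi>) \<longlonglongrightarrow> G \<xi>" for \<xi>
        by (rule tendsto_eventually)
      then show "AE \<xi> in lborel. (\<lambda>k. Gk k \<xi> * fourier_integral \<phi> \<xi>) \<longlonglongrightarrow> G \<xi> * fourier_integral \<phi> \<xi>"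
        by (intro AE_I2 tendsto_intros)
      fix k
      have "norm (Gk k \<xi> * fourier_integral \<phi> \<xi>) \<le> (norm (G \<xi>))\<^sup>2 + (norm (fourier_integral \<phi> \<xi>))\<^sup>2" for \<xi>
        by (intro order_trans[OF ab] add_mono power_mono Gk_le) auto
      then show "AE \<xi> in lborel. norm (Gk k \<xi> * fourier_integral \<phi> \<xi>) \<le> (norm (G \<xi>))\<^sup>2 + (norm (fourier_integral \<phi> \<xi>))\<^sup>2"
        by (intro AE_I2)
    qed simp_all
    ultimately show "(LINT x|lborel. h x * \<phi> x) = (LINT \<xi>|lborel. G \<xi> * fourier_integral \<phi> \<xi>)"
      by (simp add: LIMSEQ_unique)
  qed
qed

section \<open>Multipliers \<open>|D|\<^sup>a\<close> and the \<open>L\<^sup>2\<close> norm of a distribution\<close>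

text \<open>Decay of order \<open>2 n\<close> suffices in dimension \<open>n\<close>, because \<open>(1 + norm x) ^ (2 * n)\<close> dominates the
product of the factors \<open>1 + (x \<bullet> b)\<^sup>2\<close>, whose reciprocals are integrable on the line.\<close>

lemma schwartz_L1_L2:
  fixes \<phi> :: "real^'n \<Rightarrow> complex"
  assumes \<phi>: "\<phi> \<in> schwartz"
  shows "integrable lborel \<phi> \<and> integrable lborel (\<lambda>x. (norm (\<phi> x))\<^sup>2)"
proof -
  let ?n = "DIM(real^'n)"
  have "[] \<in> multi_indices" by (simp add: multi_indices_def)
  with \<phi> have diff: "\<phi> differentiable (at x)"
    and decay: "bounded (range (\<lambda>x. (1 + norm x) ^ k *\<^sub>R \<phi> x))" for x k
    unfolding schwartz_def by (force simp: partial_deriv_def)+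
  have "continuous_on UNIV \<phi>"
    using diff by (simp add: continuous_on_eq_continuous_at differentiable_imp_continuous_within)
  then have [measurable]: "\<phi> \<in> borel_measurable borel"
    by (rule borel_measurable_continuous_onI)
  obtain A where A: "\<And>x. norm ((1 + norm x) ^ (2 * ?n) *\<^sub>R \<phi> x) \<le> A"
    using decay[of "2 * ?n"] by (auto simp: bounded_iff)
  obtain B where B: "\<And>x. norm (\<phi> x) \<le> B"
    using decay[of 0] by (auto simp: bounded_iff)
  define w where "w x = (\<Prod>b\<in>Basis. inverse (1 + (x \<bullet> b)\<^sup>2))" for x :: "real^'n"
  have w: "integrable lborel w"
    unfolding w_def
    by (rule integrable.intros[OF has_bochner_integral_lborel_prod_inner])
      (use integrable_inverse_1_plus_square in \<open>simp add: set_integrable_def\<close>)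
  have le: "norm (\<phi> x) \<le> A * w x" for x
  proof -
    have w_pos: "w x > 0" unfolding w_def by (intro prod_pos) (simp add: add_pos_nonneg)
    have "(\<Prod>b\<in>Basis. 1 + (x \<bullet> b)\<^sup>2) \<le> (\<Prod>b\<in>(Basis::(real^'n) set). (1 + norm x)\<^sup>2)"
    proof (intro prod_mono conjI)
      fix b :: "real^'n" assume "b \<in> Basis"
      then have "(x \<bullet> b)\<^sup>2 \<le> (norm x)\<^sup>2"
        using Basis_le_norm[of b x] by (simp add: abs_le_square_iff[symmetric])
      then show "1 + (x \<bullet> b)\<^sup>2 \<le> (1 + norm x)\<^sup>2"
        by (simp add: power2_sum, use norm_ge_zero[of x] in linarith)
    qed simp
    also have "\<dots> = (1 + norm x) ^ (2 * ?n)"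
      by (simp only: prod_constant power_mult)
    also have "(\<Prod>b\<in>Basis. 1 + (x \<bullet> b)\<^sup>2) = inverse (w x)"
      by (simp add: w_def prod_inversef[symmetric])
    finally have "inverse (w x) * norm (\<phi> x) \<le> (1 + norm x) ^ (2 * ?n) * norm (\<phi> x)"
      by (rule mult_right_mono) simp
    also have "\<dots> \<le> A" using A[of x] by simp
    finally show ?thesis using w_pos by (simp add: field_simps)
  qed
  have int: "integrable lborel \<phi>"
  proof (rule Bochner_Integration.integrable_bound)
    show "integrable lborel (\<lambda>x. A * w x)" using w by simp
    show "AE x in lborel. norm (\<phi> x) \<le> norm (A * w x)"
      using order_trans[OF le abs_ge_self] by simp
  qed simp
  have "integrable lborel (\<lambda>x. (norm (\<phi> x))\<^sup>2)"
  proof (rule Bochner_Integration.integrable_bound)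
    show "integrable lborel (\<lambda>x. B * norm (\<phi> x))" using int by simp
    have sq: "(norm (\<phi> x))\<^sup>2 \<le> B * norm (\<phi> x)" for x
      using B[of x] by (simp add: power2_eq_square mult_right_mono)
    show "AE x in lborel. norm ((norm (\<phi> x))\<^sup>2) \<le> norm (B * norm (\<phi> x))"
      using order_trans[OF sq abs_ge_self] by simp
  qed simp
  with int show ?thesis by blast
qed

lemma L2_norm_fun_eq_nn_integral:
  assumes "square_integrable f"
  shows "(L2_norm_fun f)\<^sup>2 = (\<integral>\<^sup>+x. ennreal ((norm (f x))\<^sup>2) \<partial>lborel)"
proof -
  have "(L2_norm_fun f)\<^sup>2 = ennreal (LINT x|lborel. (norm (f x))\<^sup>2)"
    using assms by (simp add: L2_norm_fun_def ennreal_power)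
  then show ?thesis
    using assms by (subst nn_integral_eq_integral) (auto simp: square_integrable_def)
qed

text \<open>Only test functions enter the definition of the norm of a distribution. They lie in both \<open>L\<^sup>1\<close> and \<open>L\<^sup>2\<close>, so the
function constructed in \<open>L2_fourier_transform_exists\<close>, multiplied by the normalising factor \<open>c\<close>,
represents the distribution \<open>abs_D a T\<close>. The factor \<open>c\<^sup>2\<close> cancels the constant in the Plancherel inequality. If
the right-hand side is infinite, there is nothing to prove.\<close>

lemma L2_norm_dist_abs_D_le:
  fixes T :: "(real^'n \<Rightarrow> complex) \<Rightarrow> complex"
  shows "L2_norm_dist (abs_D a T) \<le> L2_norm_fun (\<lambda>\<xi>. of_real (norm \<xi> powr a) * fhat T \<xi>)"
proof (cases "square_integrable (\<lambda>\<xi>. of_real (norm \<xi> powr a) * fhat T \<xi>)")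
  case False
  then show ?thesis by (simp add: L2_norm_fun_def)
next
  case True
  define G where "G \<xi> = of_real (norm \<xi> powr a) * fhat T \<xi>" for \<xi>
  have sq: "square_integrable G" using True by (simp add: G_def[abs_def])
  then have "G \<in> borel_measurable lborel" "integrable lborel (\<lambda>\<xi>. (norm (G \<xi>))\<^sup>2)"
    by (auto simp: square_integrable_def)
  from L2_fourier_transform_exists[OF this]
  obtain h where [measurable]: "h \<in> borel_measurable lborel"
    and h_norm: "(\<integral>\<^sup>+x. ennreal ((norm (h x))\<^sup>2) \<partial>lborel) \<le>
      ennreal ((2 * pi) ^ DIM(real^'n)) * (\<integral>\<^sup>+\<xi>. ennreal ((norm (G \<xi>))\<^sup>2) \<partial>lborel)"
    and h_dual: "\<And>\<phi>. integrable lborel \<phi> \<Longrightarrow> integrable lborel (\<lambda>x. (norm (\<phi> x))\<^sup>2) \<Longrightarrow>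
      (LINT x|lborel. h x * \<phi> x) = (LINT \<xi>|lborel. G \<xi> * fourier_integral \<phi> \<xi>)"
    by blast
  define c where "c = (2 * pi) powr (- real CARD('n) / 2)"
  define k where "k x = of_real c * h x" for x
  have [measurable]: "k \<in> borel_measurable lborel" unfolding k_def by measurable
  have "c\<^sup>2 = (2 * pi) powr (- real CARD('n))"
    by (simp add: c_def power2_eq_square powr_add[symmetric])
  moreover have "(2 * pi) ^ DIM(real^'n) = (2 * pi) powr real CARD('n)"
    by (subst powr_realpow) simp_all
  ultimately have c2: "c\<^sup>2 * (2 * pi) ^ DIM(real^'n) = 1"
    by (simp only: powr_add[symmetric]) simp
  have "(\<integral>\<^sup>+x. ennreal ((norm (k x))\<^sup>2) \<partial>lborel) = ennreal (c\<^sup>2) * (\<integral>\<^sup>+x. ennreal ((norm (h x))\<^sup>2) \<partial>lborel)"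
    by (simp add: k_def norm_mult power_mult_distrib ennreal_mult nn_integral_cmult)
  also have "\<dots> \<le> ennreal (c\<^sup>2) * (ennreal ((2 * pi) ^ DIM(real^'n)) * (\<integral>\<^sup>+\<xi>. ennreal ((norm (G \<xi>))\<^sup>2) \<partial>lborel))"
    by (intro mult_left_mono h_norm) simp
  also have "\<dots> = ennreal (c\<^sup>2 * (2 * pi) ^ DIM(real^'n)) * (\<integral>\<^sup>+\<xi>. ennreal ((norm (G \<xi>))\<^sup>2) \<partial>lborel)"
    by (subst ennreal_mult) (simp_all only: mult.assoc zero_le_power2 zero_le_power pi_ge_zero mult_nonneg_nonneg zero_le_numeral)
  also have "\<dots> = (L2_norm_fun G)\<^sup>2"
    by (simp only: c2 ennreal_1 mult_1 L2_norm_fun_eq_nn_integral[OF sq])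
  finally have k_le: "(\<integral>\<^sup>+x. ennreal ((norm (k x))\<^sup>2) \<partial>lborel) \<le> (L2_norm_fun G)\<^sup>2" .
  have "(L2_norm_fun G)\<^sup>2 < \<infinity>"
    using sq by (simp add: L2_norm_fun_def ennreal_power)
  with k_le have k_sq: "square_integrable k"
    by (auto simp: square_integrable_def integrable_iff_bounded intro: le_less_trans)
  have "(LINT x|lborel. k x * \<phi> x) = abs_D a T \<phi>" if "\<phi> \<in> test_Z" for \<phi>
  proof -
    have "\<phi> \<in> schwartz" using that by (simp add: test_Z_def)
    then have dual: "(LINT x|lborel. h x * \<phi> x) = (LINT \<xi>|lborel. G \<xi> * fourier_integral \<phi> \<xi>)"
      by (intro h_dual) (auto dest: schwartz_L1_L2)
    have "(LINT x|lborel. k x * \<phi> x) = of_real c * (LINT x|lborel. h x * \<phi> x)"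
      by (simp add: k_def mult.assoc)
    also have "\<dots> = (LINT \<xi>|lborel. of_real c * (G \<xi> * fourier_integral \<phi> \<xi>))"
      unfolding dual by (rule integral_mult_right_zero[symmetric])
    also have "\<dots> = abs_D a T \<phi>"
      by (simp only: abs_D_def fourier_multiplier_def G_def inv_fourier_def
          fourier_integral_def c_def mult_ac)
    finally show ?thesis .
  qed
  then have "L2_norm_dist (abs_D a T) \<le> L2_norm_fun k"
    unfolding L2_norm_dist_def using k_sq by (intro INF_lower) auto
  also have "\<dots> \<le> L2_norm_fun G"
    using k_le unfolding L2_norm_fun_eq_nn_integral[OF k_sq, symmetric]
    using k_sq sq by (simp add: L2_norm_fun_def ennreal_power)
  finally show ?thesis by (simp add: G_def[abs_def])
qed

text \<open>The factor 2 comes from \<open>square_add_le\<close>, a cheap substitute for Minkowski's inequality.\<close>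

lemma L2_norm_fun_le_add:
  fixes f g h :: "real^'n \<Rightarrow> complex"
  assumes [measurable]: "f \<in> borel_measurable lborel"
    and le: "AE x in lborel. norm (f x) \<le> norm (g x) + norm (h x)"
  shows "L2_norm_fun f \<le> ennreal 2 * (L2_norm_fun g + L2_norm_fun h)"
proof (cases "square_integrable g \<and> square_integrable h")
  case False
  then have top: "L2_norm_fun g + L2_norm_fun h = \<infinity>"
    by (auto simp: L2_norm_fun_def)
  show ?thesis unfolding top by (simp add: ennreal_mult_top)
next
  case True
  then have g: "integrable lborel (\<lambda>x. (norm (g x))\<^sup>2)" and h: "integrable lborel (\<lambda>x. (norm (h x))\<^sup>2)"
    by (auto simp: square_integrable_def)
  let ?A = "LINT x|lborel. (norm (g x))\<^sup>2" and ?B = "LINT x|lborel. (norm (h x))\<^sup>2"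
  have bound: "AE x in lborel. (norm (f x))\<^sup>2 \<le> 2 * (norm (g x))\<^sup>2 + 2 * (norm (h x))\<^sup>2"
    using le
  proof eventually_elim
    case (elim x)
    then have "(norm (f x))\<^sup>2 \<le> (norm (g x) + norm (h x))\<^sup>2"
      by (intro power_mono) auto
    also note square_add_le
    finally show ?case .
  qed
  have gh: "integrable lborel (\<lambda>x. 2 * (norm (g x))\<^sup>2 + 2 * (norm (h x))\<^sup>2)"
    using g h by simp
  have f: "integrable lborel (\<lambda>x. (norm (f x))\<^sup>2)"
    by (rule Bochner_Integration.integrable_bound[OF gh]) (use bound in auto)
  have "(LINT x|lborel. (norm (f x))\<^sup>2) \<le> (LINT x|lborel. 2 * (norm (g x))\<^sup>2 + 2 * (norm (h x))\<^sup>2)"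
    by (rule integral_mono_AE[OF f gh bound])
  also have "\<dots> = 2 * ?A + 2 * ?B"
    using g h by simp
  also have "\<dots> \<le> (2 * (sqrt ?A + sqrt ?B))\<^sup>2"
  proof -
    have "?A \<ge> 0" "?B \<ge> 0" by simp_all
    then have "(2 * (sqrt ?A + sqrt ?B))\<^sup>2 = 4 * ?A + 4 * ?B + 8 * (sqrt ?A * sqrt ?B)"
      by (simp add: power_mult_distrib power2_sum)
    moreover have "sqrt ?A * sqrt ?B \<ge> 0" by simp
    ultimately show ?thesis using \<open>?A \<ge> 0\<close> \<open>?B \<ge> 0\<close> by linarith
  qed
  finally have "sqrt (LINT x|lborel. (norm (f x))\<^sup>2) \<le> 2 * (sqrt ?A + sqrt ?B)"
    by (intro real_le_lsqrt) auto
  then have "ennreal (sqrt (LINT x|lborel. (norm (f x))\<^sup>2)) \<le> ennreal 2 * (ennreal (sqrt ?A) + ennreal (sqrt ?B))"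
    by (simp add: ennreal_leI flip: ennreal_plus ennreal_mult ennreal_numeral)
  then show ?thesis
    using True f by (simp add: L2_norm_fun_def square_integrable_def)
qed

section \<open>The energy estimate\<close>

text \<open>The equation is that of an oscillator with frequency \<open>r\<close> and friction \<open>d t\<close>. The derivative of its
energy is \<open>- 2 * d t * (norm (V t))\<^sup>2\<close>, hence not positive.\<close>

lemma energy_nonincreasing:
  fixes U V :: "real \<Rightarrow> complex" and d :: "real \<Rightarrow> real" and r :: real
  assumes U: "\<And>t. t \<ge> 0 \<Longrightarrow> (U has_vector_derivative V t) (at t within {0..})"
    and V: "\<And>t. t \<ge> 0 \<Longrightarrow> \<exists>w. (V has_vector_derivative w) (at t within {0..}) \<and>
        w + of_real (r\<^sup>2) * U t + of_real (d t) * V t = 0"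
    and d: "\<And>t. t \<ge> 0 \<Longrightarrow> d t \<ge> 0"
    and t: "t \<ge> 0"
  shows "(norm (V t))\<^sup>2 + r\<^sup>2 * (norm (U t))\<^sup>2 \<le> (norm (V 0))\<^sup>2 + r\<^sup>2 * (norm (U 0))\<^sup>2"
proof -
  let ?E = "\<lambda>s. V s \<bullet> V s + r\<^sup>2 * (U s \<bullet> U s)"
  have E: "(?E has_derivative (\<lambda>x. x * (- 2 * d s * (V s \<bullet> V s)))) (at s within {0..t})"
    if "0 \<le> s" "s \<le> t" for s
  proof -
    from V[OF \<open>0 \<le> s\<close>] obtain w where w: "(V has_vector_derivative w) (at s within {0..})"
      and eq: "w + of_real (r\<^sup>2) * U s + of_real (d s) * V s = 0" by blast
    have sub: "{0..t} \<subseteq> {0..}" by auto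
    note dU = has_vector_derivative_within_subset[OF U[OF \<open>0 \<le> s\<close>] sub, unfolded has_vector_derivative_def]
    note dV = has_vector_derivative_within_subset[OF w sub, unfolded has_vector_derivative_def]
    have w_eq: "w = - (r\<^sup>2 *\<^sub>R U s) - d s *\<^sub>R V s"
      using eq by (simp add: scaleR_conv_of_real eq_neg_iff_add_eq_0 algebra_simps)
    have energy: "2 * (V s \<bullet> w) + r\<^sup>2 * (2 * (U s \<bullet> V s)) = - 2 * d s * (V s \<bullet> V s)"
      by (simp add: w_eq inner_diff_right inner_commute algebra_simps)
    have "(?E has_derivative (\<lambda>x. (V s \<bullet> (x *\<^sub>R w) + (x *\<^sub>R w) \<bullet> V s) +
        r\<^sup>2 * (U s \<bullet> (x *\<^sub>R V s) + (x *\<^sub>R V s) \<bullet> U s))) (at s within {0..t})"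
      by (intro derivative_intros dU dV)
    moreover have "V s \<bullet> (x *\<^sub>R w) + (x *\<^sub>R w) \<bullet> V s + r\<^sup>2 * (U s \<bullet> (x *\<^sub>R V s) + (x *\<^sub>R V s) \<bullet> U s) =
        x * (- 2 * d s * (V s \<bullet> V s))" for x
      unfolding energy[symmetric] by (simp add: inner_commute algebra_simps)
    ultimately show ?thesis by simp
  qed
  obtain s where s: "s \<in> {0..t}" and diff: "?E t - ?E 0 = (t - 0) * (- 2 * d s * (V s \<bullet> V s))"
    using mvt_very_simple[OF t E] by blast
  have "0 \<le> t * (2 * d s * (V s \<bullet> V s))"
    using t s d[of s] by (intro mult_nonneg_nonneg) auto
  with diff have "?E t \<le> ?E 0"
    by (simp add: algebra_simps)
  then show ?thesis
    by (simp add: power2_norm_eq_inner)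
qed

lemma fhat_measurable:
  assumes "has_fhat T"
  shows "fhat T \<in> borel_measurable lborel"
proof -
  have "fourier_repr T (fhat T)"
    using assms unfolding has_fhat_def fhat_def by (rule someI_ex)
  then show ?thesis by (simp add: fourier_repr_def)
qed

text \<open>The square root of the initial energy is at most \<open>norm \<xi> * norm (fhat u0 \<xi>) + norm (fhat u1 \<xi>)\<close>, and
each of the two terms of the energy at time \<open>t\<close> is bounded by the initial energy. At the
excluded frequency \<open>\<xi> = 0\<close> the powers of \<open>norm \<xi>\<close> by which the bounds are later multiplied do not
obey the law of exponents, since \<open>0 powr a = 0\<close> for every \<open>a\<close>.\<close>

lemma sobolev_solution_pointwise:
  fixes u0 u1 :: "(real^'n \<Rightarrow> complex) \<Rightarrow> complex"
  assumes sol: "sobolev_solution b g u0 u1 u ut"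
    and bg: "\<forall>t\<ge>0. b t \<ge> 0" "\<forall>t\<ge>0. g t \<ge> 0" and t: "t \<ge> 0"
  shows "AE \<xi> in lborel. \<xi> \<noteq> 0 \<and>
      norm (fhat (ut t) \<xi>) \<le> norm \<xi> * norm (fhat u0 \<xi>) + norm (fhat u1 \<xi>) \<and>
      norm \<xi> * norm (fhat (u t) \<xi>) \<le> norm \<xi> * norm (fhat u0 \<xi>) + norm (fhat u1 \<xi>)"
proof -
  from sol obtain U V :: "real \<Rightarrow> real^'n \<Rightarrow> complex" where
    repr: "\<And>t. t \<ge> 0 \<Longrightarrow> AE \<xi> in lborel. U t \<xi> = fhat (u t) \<xi> \<and> V t \<xi> = fhat (ut t) \<xi>"
    and ode: "AE \<xi> in lborel. U 0 \<xi> = fhat u0 \<xi> \<and> V 0 \<xi> = fhat u1 \<xi> \<and>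
           (\<forall>t\<ge>0. ((\<lambda>s. U s \<xi>) has_vector_derivative V t \<xi>) (at t within {0..}) \<and>
              (\<exists>w. ((\<lambda>s. V s \<xi>) has_vector_derivative w) (at t within {0..}) \<and>
                 w + of_real ((norm \<xi>)\<^sup>2) * U t \<xi>
                   + of_real (b t + g t * (norm \<xi>)\<^sup>2) * V t \<xi> = 0))"
    unfolding sobolev_solution_def by blast
  have "AE \<xi> in lborel. \<xi> \<noteq> (0 :: real^'n)"
    by (rule AE_lborel_singleton)
  with repr[OF t] ode show ?thesis
  proof eventually_elim
    case (elim \<xi>)
    have "(norm (V t \<xi>))\<^sup>2 + (norm \<xi>)\<^sup>2 * (norm (U t \<xi>))\<^sup>2 \<le> (norm (V 0 \<xi>))\<^sup>2 + (norm \<xi>)\<^sup>2 * (norm (U 0 \<xi>))\<^sup>2"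
      by (rule energy_nonincreasing[where d = "\<lambda>t. b t + g t * (norm \<xi>)\<^sup>2"])
        (use elim bg t in auto)
    also have "\<dots> \<le> (norm \<xi> * norm (U 0 \<xi>) + norm (V 0 \<xi>))\<^sup>2"
      by (simp add: power2_sum power_mult_distrib)
    finally have "(norm (V t \<xi>))\<^sup>2 + (norm \<xi> * norm (U t \<xi>))\<^sup>2 \<le> (norm \<xi> * norm (U 0 \<xi>) + norm (V 0 \<xi>))\<^sup>2"
      by (simp only: power_mult_distrib)
    then have "(norm (V t \<xi>))\<^sup>2 \<le> (norm \<xi> * norm (U 0 \<xi>) + norm (V 0 \<xi>))\<^sup>2"
      "(norm \<xi> * norm (U t \<xi>))\<^sup>2 \<le> (norm \<xi> * norm (U 0 \<xi>) + norm (V 0 \<xi>))\<^sup>2"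
      using zero_le_power2[of "norm \<xi> * norm (U t \<xi>)"] zero_le_power2[of "norm (V t \<xi>)"]
      by linarith+
    then have "norm (V t \<xi>) \<le> norm \<xi> * norm (U 0 \<xi>) + norm (V 0 \<xi>)"
      "norm \<xi> * norm (U t \<xi>) \<le> norm \<xi> * norm (U 0 \<xi>) + norm (V 0 \<xi>)"
      by (auto intro: power2_le_imp_le)
    with elim show ?case by simp
  qed
qed

text \<open>The pointwise bound for \<open>norm \<xi> * norm (fhat (u t) \<xi>)\<close> is multiplied by \<open>norm \<xi> powr (\<beta> - 1)\<close>, the one
for the time derivative below by \<open>norm \<xi> powr \<beta>\<close>.\<close>

lemma sobolev_solution_estimate:
  fixes u0 u1 :: "(real^'n \<Rightarrow> complex) \<Rightarrow> complex"
  assumes sol: "sobolev_solution b g u0 u1 u ut"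
    and bg: "\<forall>t\<ge>0. b t \<ge> 0" "\<forall>t\<ge>0. g t \<ge> 0" and t: "t \<ge> 0"
  shows "L2_norm_dist (abs_D \<beta> (u t)) \<le> ennreal 2 * (Hdot_norm \<beta> u0 + Hdot_norm (\<beta> - 1) u1)"
proof -
  have fhat: "has_fhat u0" "has_fhat u1" "has_fhat (u t)" "has_fhat (ut t)"
    using sol t by (auto simp: sobolev_solution_def)
  note [measurable] = fhat_measurable[OF fhat(3)]
  have powr_times: "x powr a * x = x powr (a + 1)" if "x > 0" for x a :: real
    using that by (simp add: powr_add)
  note pointwise = sobolev_solution_pointwise[OF assms]
  have "AE \<xi> in lborel. norm (of_real (norm \<xi> powr \<beta>) * fhat (u t) \<xi>) \<le>
      norm (of_real (norm \<xi> powr \<beta>) * fhat u0 \<xi>) + norm (of_real (norm \<xi> powr (\<beta> - 1)) * fhat u1 \<xi>)"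
    using pointwise
  proof eventually_elim
    case (elim \<xi>)
    then have "norm \<xi> powr (\<beta> - 1) * (norm \<xi> * norm (fhat (u t) \<xi>)) \<le>
        norm \<xi> powr (\<beta> - 1) * (norm \<xi> * norm (fhat u0 \<xi>) + norm (fhat u1 \<xi>))"
      by (intro mult_left_mono) auto
    then show ?case
      using powr_times[of "norm \<xi>" "\<beta> - 1"] elim
      by (simp add: norm_mult distrib_left mult.assoc[symmetric])
  qed
  then have "L2_norm_fun (\<lambda>\<xi>. of_real (norm \<xi> powr \<beta>) * fhat (u t) \<xi>) \<le>
      ennreal 2 * (Hdot_norm \<beta> u0 + Hdot_norm (\<beta> - 1) u1)"
    unfolding Hdot_norm_def if_P[OF fhat(1)] if_P[OF fhat(2)] by (rule L2_norm_fun_le_add[rotated]) simp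
  with L2_norm_dist_abs_D_le
  show ?thesis
    by (rule order_trans)
qed

lemma sobolev_solution_time_derivative_estimate:
  fixes u0 u1 :: "(real^'n \<Rightarrow> complex) \<Rightarrow> complex"
  assumes sol: "sobolev_solution b g u0 u1 u ut"
    and bg: "\<forall>t\<ge>0. b t \<ge> 0" "\<forall>t\<ge>0. g t \<ge> 0" and t: "t \<ge> 0"
  shows "L2_norm_dist (abs_D \<beta> (ut t)) \<le> ennreal 2 * (Hdot_norm (\<beta> + 1) u0 + Hdot_norm \<beta> u1)"
proof -
  have fhat: "has_fhat u0" "has_fhat u1" "has_fhat (u t)" "has_fhat (ut t)"
    using sol t by (auto simp: sobolev_solution_def)
  note [measurable] = fhat_measurable[OF fhat(4)]
  have powr_times: "x powr a * x = x powr (a + 1)" if "x > 0" for x a :: real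
    using that by (simp add: powr_add)
  note pointwise = sobolev_solution_pointwise[OF assms]
  have "AE \<xi> in lborel. norm (of_real (norm \<xi> powr \<beta>) * fhat (ut t) \<xi>) \<le>
      norm (of_real (norm \<xi> powr (\<beta> + 1)) * fhat u0 \<xi>) + norm (of_real (norm \<xi> powr \<beta>) * fhat u1 \<xi>)"
    using pointwise
  proof eventually_elim
    case (elim \<xi>)
    then have "norm \<xi> powr \<beta> * norm (fhat (ut t) \<xi>) \<le>
        norm \<xi> powr \<beta> * (norm \<xi> * norm (fhat u0 \<xi>) + norm (fhat u1 \<xi>))"
      by (intro mult_left_mono) auto
    then show ?case
      using powr_times[of "norm \<xi>" \<beta>] elim
      by (simp add: norm_mult distrib_left mult.assoc[symmetric])
  qed
  then have "L2_norm_fun (\<lambda>\<xi>. of_real (norm \<xi> powr \<beta>) * fhat (ut t) \<xi>) \<le>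
      ennreal 2 * (Hdot_norm (\<beta> + 1) u0 + Hdot_norm \<beta> u1)"
    unfolding Hdot_norm_def if_P[OF fhat(1)] if_P[OF fhat(2)] by (rule L2_norm_fun_le_add[rotated]) simp
  with L2_norm_dist_abs_D_le
  show ?thesis
    by (rule order_trans)
qed

theorem theorem5p3:
  fixes \<beta> :: real
  shows "(\<beta> \<ge> 1 \<longrightarrow>
      (\<exists>C>0. \<forall>(u0 :: (real^'n \<Rightarrow> complex) \<Rightarrow> complex) u1 u ut.
        sobolev_solution (\<lambda>t. exp t) (\<lambda>t. exp (- t) / 2) u0 u1 u ut \<longrightarrow>
        (\<forall>t\<ge>0. L2_norm_dist (abs_D \<beta> (u t)) \<le>
           ennreal C * (Hdot_Int_norm \<beta> (\<beta> + 1) u0 + Hdot_Int_norm (\<beta> - 1) \<beta> u1)))) \<and>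
    (\<beta> \<ge> 0 \<longrightarrow>
      (\<exists>C>0. \<forall>(u0 :: (real^'n \<Rightarrow> complex) \<Rightarrow> complex) u1 u ut.
        sobolev_solution (\<lambda>t. exp t) (\<lambda>t. exp (- t) / 2) u0 u1 u ut \<longrightarrow>
        (\<forall>t\<ge>0. L2_norm_dist (abs_D \<beta> (ut t)) \<le>
           ennreal C * (Hdot_Int_norm (\<beta> + 1) (\<beta> + 2) u0 + Hdot_Int_norm \<beta> (\<beta> + 1) u1))))"
proof -
  have le: "Hdot_norm a T \<le> Hdot_Int_norm a a' T" for a a' and T :: "(real^'n \<Rightarrow> complex) \<Rightarrow> complex"
    by (simp add: Hdot_Int_norm_def)
  have est: "L2_norm_dist (abs_D \<beta> (u t)) \<le>
      ennreal 2 * (Hdot_Int_norm \<beta> (\<beta> + 1) u0 + Hdot_Int_norm (\<beta> - 1) \<beta> u1)"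
    "L2_norm_dist (abs_D \<beta> (ut t)) \<le>
      ennreal 2 * (Hdot_Int_norm (\<beta> + 1) (\<beta> + 2) u0 + Hdot_Int_norm \<beta> (\<beta> + 1) u1)"
    if sol: "sobolev_solution (\<lambda>t. exp t) (\<lambda>t. exp (- t) / 2) u0 u1 u ut" and t: "t \<ge> 0"
    for t u ut and u0 u1 :: "(real^'n \<Rightarrow> complex) \<Rightarrow> complex"
    by (rule order_trans[OF sobolev_solution_estimate[OF sol _ _ t]]
          order_trans[OF sobolev_solution_time_derivative_estimate[OF sol _ _ t]];
        auto intro!: mult_left_mono add_mono le)+
  show ?thesis
    by (intro conjI impI exI[of _ 2] allI est) auto
qed

end
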